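(* Let $d\geq 2$ be an integer. Then: (i) for every simple planar quadrangulated graph $G$ with $n$ vertices and every $d$-independent set $I$ of $G$, $|I|\leq \frac{2}{d}(n-2)$; (ii) for arbitrarily large $n$ there exists a simple planar quadrangulated graph with $n$ vertices that has a $d$-independent set of size exactly $\frac{2}{d}(n-2)$. That is, the $d$-independence number of simple planar quadrangulated graphs is exactly $\frac{2}{d}(n-2)$.
   Context: Throughout, graphs are connected with $n\geq 3$ vertices. A $d$-independent set of a graph $G$ is an independent set $I$ such that every vertex of $I$ has degree at least $d$ in $G$. A graph is quadrangulated if it has a planar drawing in which every face is bounded by a $4$-cycle. *)

theory Defs
  imports "HOL-Analysis.Analysis" "Graph_Theory.Graph_Theory"
begin

text \<open>
  A finite simple undirected graph is a \<^locale>\<open>pair_graph\<close>: a finite, loop-free, symmetric digraph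
  without parallel arcs. Each edge $uv$ is represented by the two arcs $(u,v)$ and $(v,u)$, so the
  degree of a vertex in the undirected graph is its \<^const>\<open>out_degree\<close>.
\<close>

definition independent_set :: "'a pair_pre_digraph \<Rightarrow> 'a set \<Rightarrow> bool" where
  "independent_set G I \<longleftrightarrow> I \<subseteq> pverts G \<and> (\<forall>u\<in>I. \<forall>v\<in>I. (u, v) \<notin> parcs G)"

definition d_independent_set :: "nat \<Rightarrow> 'a pair_pre_digraph \<Rightarrow> 'a set \<Rightarrow> bool" where
  "d_independent_set d G I \<longleftrightarrow>
     independent_set G I \<and> (\<forall>v\<in>I. d \<le> out_degree (with_proj G) v)"

text \<open>
  The plane is \<^typ>\<open>complex\<close>. The two arcs of an edge carry the same curve, traversed in opposite
  directions.
\<close>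

definition plane_drawing ::
  "'a pair_pre_digraph \<Rightarrow> ('a \<Rightarrow> complex) \<Rightarrow> ('a \<times> 'a \<Rightarrow> real \<Rightarrow> complex) \<Rightarrow> bool" where
  "plane_drawing G p \<gamma> \<longleftrightarrow>
     inj_on p (pverts G) \<and>
     (\<forall>u v. (u, v) \<in> parcs G \<longrightarrow>
        Path_Connected.arc (\<gamma> (u, v)) \<and>
        pathstart (\<gamma> (u, v)) = p u \<and> pathfinish (\<gamma> (u, v)) = p v \<and>
        \<gamma> (v, u) = reversepath (\<gamma> (u, v)) \<and>
        path_image (\<gamma> (u, v)) \<inter> p ` pverts G = {p u, p v}) \<and>
     (\<forall>u v x y. (u, v) \<in> parcs G \<longrightarrow> (x, y) \<in> parcs G \<longrightarrow> {u, v} \<noteq> {x, y} \<longrightarrow>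
        path_image (\<gamma> (u, v)) \<inter> path_image (\<gamma> (x, y)) = p ` ({u, v} \<inter> {x, y}))"

definition drawing_image ::
  "'a pair_pre_digraph \<Rightarrow> ('a \<Rightarrow> complex) \<Rightarrow> ('a \<times> 'a \<Rightarrow> real \<Rightarrow> complex) \<Rightarrow> complex set" where
  "drawing_image G p \<gamma> = p ` pverts G \<union> (\<Union>e\<in>parcs G. path_image (\<gamma> e))"

text \<open>The unbounded component is a face as well.\<close>

definition drawing_faces ::
  "'a pair_pre_digraph \<Rightarrow> ('a \<Rightarrow> complex) \<Rightarrow> ('a \<times> 'a \<Rightarrow> real \<Rightarrow> complex) \<Rightarrow> complex set set" where
  "drawing_faces G p \<gamma> = components (- drawing_image G p \<gamma>)"

text \<open>
  \<^const>\<open>pre_digraph.cycle\<close> demands distinct vertices, so its instances of length 4 are exactly the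
  (oriented) 4-cycles of the undirected graph.
\<close>

definition bounded_by_4_cycle ::
  "'a pair_pre_digraph \<Rightarrow> ('a \<times> 'a \<Rightarrow> real \<Rightarrow> complex) \<Rightarrow> complex set \<Rightarrow> bool" where
  "bounded_by_4_cycle G \<gamma> F \<longleftrightarrow>
     (\<exists>c. pre_digraph.cycle (with_proj G) c \<and> length c = 4 \<and>
          frontier F = (\<Union>e\<in>set c. path_image (\<gamma> e)))"

definition quadrangulated :: "'a pair_pre_digraph \<Rightarrow> bool" where
  "quadrangulated G \<longleftrightarrow>
     (\<exists>p \<gamma>. plane_drawing G p \<gamma> \<and> (\<forall>F\<in>drawing_faces G p \<gamma>. bounded_by_4_cycle G \<gamma> F))"

text \<open>Connectedness and the lower bound on the order are standing assumptions on all graphs.\<close>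

definition simple_quadrangulated_graph :: "'a pair_pre_digraph \<Rightarrow> bool" where
  "simple_quadrangulated_graph G \<longleftrightarrow>
     pair_graph G \<and> Digraph_Component.connected (with_proj G) \<and> 3 \<le> card (pverts G) \<and>
     quadrangulated G"

end

theory Submission
  imports Defs
begin

text \<open>
  Upper bound: an independent set of vertices of degree at least $d$ accounts for at least $d|I|$
  edges, and a quadrangulation has at most $2(n-2)$ edges. The latter combines two estimates for the
  number $f$ of faces. Growing the graph edge by edge while keeping it connected, every edge that
  closes a cycle splits a face by the Jordan curve theorem, so $f \<ge> m - n + 2$. Conversely, an edge
  on a cycle $C$ meets at most one face on either side of $C$: by Janiszewski's theorem, two points
  close to the middle of the edge and on the same side of $C$ are not separated by the drawing, because
  the rest of the drawing meets $C$ in a connected set. Hence $4f \<le> 2m$.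

  Sharpness: glue $r$ copies of $K_{2,d}$, with parts $\{v,v'\}$ and $\{N,S,w_1,\dots,w_{d-2}\}$, at
  the poles $N$ and $S$. The $2r$ vertices $v,v'$ have degree $d$ and $n = rd + 2$. This graph arises
  from a 4-cycle by repeatedly placing a vertex in a face and joining it to two opposite corners.
\<close>

text \<open>The two face estimates are one-sided and point in opposite directions; eliminating $f$
  leaves $m \<le> 2n - 4$. In the code every edge counts twice, once per arc. The obstacle in
  counting faces is finiteness: a priori a drawing could have infinitely many faces, and
  \<open>card\<close> would then be 0. Hence the Euler estimate speaks of some finite family of
  faces, and finiteness comes out of the double count, since each face uses up arcs and there are
  only finitely many of those. The topology is concentrated at the midpoint of an edge, a point with
  a neighbourhood that no other part of the drawing enters: a new edge splits the face around its
  midpoint, and a face bounded by an edge comes arbitrarily close to that midpoint. In the sharp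
  example $|I| = 2r$ and $n - 2 = rd$, so the bound is met with equality. The blocks are grown
  inside successive faces because each insertion then alters a single face, and that face is known
  through an injective continuous image of a closed diamond. The outer face has no such description,
  and nothing is ever put into it.\<close>

hide_const (open) Digraph_Component.connected

section \<open>Plane arcs and complementary components\<close>

text \<open>An arc is homeomorphic to an interval, so a nonempty open set inside it would embed into
  the real line, against invariance of dimension.\<close>

lemma interior_arc_image:
  fixes g :: "real \<Rightarrow> complex"
  assumes "arc g"
  shows "interior (path_image g) = {}"
proof (rule ccontr)
  assume ne: "interior (path_image g) \<noteq> {}"
  obtain h k where "homeomorphism (path_image g) {0..1::real} h k"
    using homeomorphic_arc_image_interval[OF assms, of 0 1] by (auto simp: homeomorphic_def)
  then have "continuous_on (path_image g) h" "inj_on h (path_image g)"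
    by (auto simp: homeomorphism_def inj_on_def) metis
  then have "continuous_on (interior (path_image g)) h" "inj_on h (interior (path_image g))"
    by (meson continuous_on_subset inj_on_subset interior_subset)+
  with ne show False
    using invariance_of_dimension[of "interior (path_image g)" h] by simp
qed

text \<open>\<open>U\<close> is open and an arc has empty interior, so some point of
  \<open>U\<close> survives; its component in the smaller complement cannot leave \<open>U\<close>.
  Thus drawing a further arc never loses a face.\<close>

lemma component_Un_arc_subset:
  fixes K :: "complex set"
  assumes K: "closed K" and g: "arc g" and U: "U \<in> components (- K)"
  shows "\<exists>W \<in> components (- (K \<union> path_image g)). W \<subseteq> U"
proof -
  have "open U" using K U by (auto intro: open_components)
  moreover have "U \<noteq> {}" using U by (rule in_components_nonempty)
  ultimately have "\<not> U \<subseteq> path_image g"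
    using interior_arc_image[OF g] interior_maximal by blast
  then obtain x where x: "x \<in> U" "x \<notin> path_image g" by blast
  have "x \<in> - (K \<union> path_image g)" using x U in_components_subset by fastforce
  then obtain W where W: "W \<in> components (- (K \<union> path_image g))" "x \<in> W"
    by (metis UnionE Union_components)
  have "W \<subseteq> U"
  proof (rule components_maximal[OF U])
    show "connected W" using W in_components_connected by blast
    show "W \<subseteq> - K" using W in_components_subset by fastforce
  qed (use x W in blast)
  with W show ?thesis by blast
qed

lemma arc_midpoint:
  assumes "arc g"
  shows "g (1/2) \<in> path_image g" "g (1/2) \<noteq> pathstart g" "g (1/2) \<noteq> pathfinish g"
proof -
  have "inj_on g {0..1}" using assms by (simp add: arc_def)
  then show "g (1/2) \<in> path_image g" "g (1/2) \<noteq> pathstart g" "g (1/2) \<noteq> pathfinish g"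
    using inj_onD[of g "{0..1}" "1/2" 0] inj_onD[of g "{0..1}" "1/2" 1]
    by (auto simp: path_image_def pathstart_def pathfinish_def)
qed

lemma frontier_meets_ball:
  assumes "m \<in> frontier F" "r > 0"
  shows "\<exists>x \<in> F. x \<in> ball m r"
  using assms closure_approachable[of m F] by (auto simp: frontier_def dist_commute)

text \<open>The chord \<open>g\<close> closes up through \<open>K\<close> to a simple closed curve.
  A small disc around the midpoint of \<open>g\<close> misses \<open>K\<close>, hence lies in one
  face \<open>U\<close>, but it contains points inside and outside the curve, which the chord
  separates.\<close>

lemma component_split_by_chord:
  fixes K :: "complex set"
  assumes K: "compact K" "path_connected K" and g: "arc g"
    and Kg: "K \<inter> path_image g = {pathstart g, pathfinish g}"
  shows "\<exists>U \<in> components (- K). \<exists>W1 \<in> components (- (K \<union> path_image g)).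
           \<exists>W2 \<in> components (- (K \<union> path_image g)). W1 \<noteq> W2 \<and> W1 \<subseteq> U \<and> W2 \<subseteq> U"
proof -
  have "pathstart g \<in> K" "pathfinish g \<in> K" "pathstart g \<noteq> pathfinish g"
    using Kg arc_distinct_ends[OF g] by auto
  then obtain h where h: "arc h" "path_image h \<subseteq> K" "pathstart h = pathfinish g" "pathfinish h = pathstart g"
    using K(2) unfolding path_connected_arcwise by metis
  define c where "c = g +++ h"
  have c: "simple_path c" "pathfinish c = pathstart c"
    unfolding c_def using g h Kg by (auto intro!: simple_path_join_loop)
  have cim: "path_image c = path_image g \<union> path_image h"
    unfolding c_def using h by (simp add: path_image_join)
  note J = Jordan_inside_outside[OF c]
  define m where "m = g (1/2)"
  have m: "m \<in> path_image c" "m \<notin> K"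
    using arc_midpoint[OF g] Kg unfolding m_def cim by auto
  have "open (- K)" using K by (simp add: compact_imp_closed open_Compl)
  then obtain r where r: "r > 0" "ball m r \<subseteq> - K"
    using m open_contains_ball by (metis ComplI)
  \<comment> \<open>By the Jordan curve theorem every point of the curve is a boundary point of both
    sides.\<close>
  have "m \<in> frontier (inside (path_image c))" "m \<in> frontier (outside (path_image c))"
    using J m by auto
  then obtain x y where x: "x \<in> inside (path_image c)" "x \<in> ball m r"
    and y: "y \<in> outside (path_image c)" "y \<in> ball m r"
    using r frontier_meets_ball by meson
  have nin: "x \<in> - (K \<union> path_image g)" "y \<in> - (K \<union> path_image g)"
    using x y r J cim inside_no_overlap[of "path_image c"] outside_no_overlap[of "path_image c"] by blast+
  then obtain W1 W2 where W1: "W1 \<in> components (- (K \<union> path_image g))" "x \<in> W1"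
    and W2: "W2 \<in> components (- (K \<union> path_image g))" "y \<in> W2"
    by (metis UnionE Union_components)
  obtain U where U: "U \<in> components (- K)" "ball m r \<subseteq> U"
    using exists_component_superset[OF r(2)] r m by auto
  have sub: "W \<subseteq> U" if "W \<in> components (- (K \<union> path_image g))" "z \<in> W" "z \<in> ball m r" for W z
  proof (rule components_maximal[OF U(1)])
    show "connected W" using that in_components_connected by blast
    show "W \<subseteq> - K" using that in_components_subset by fastforce
  qed (use that U in blast)
  \<comment> \<open>The complement of \<open>K \<union> path_image g\<close> avoids the whole curve
    \<open>c\<close>, so none of its components can meet both sides.\<close>
  have "W1 \<noteq> W2"
  proof
    assume "W1 = W2"
    have "connected W1" using W1 in_components_connected by blast
    moreover have "W1 \<subseteq> - path_image c"
      using W1 in_components_subset h(2) cim by fastforce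
    then have "W1 \<subseteq> inside (path_image c) \<union> outside (path_image c)" using J by simp
    ultimately show False
      using connectedD[of W1 "inside (path_image c)" "outside (path_image c)"] J x y W1 W2 \<open>W1 = W2\<close> by blast
  qed
  moreover have "W1 \<subseteq> U" "W2 \<subseteq> U" using sub[OF W1 x(2)] sub[OF W2 y(2)] by simp_all
  ultimately show ?thesis using U(1) W1(1) W2(1) by blast
qed

text \<open>Near \<open>m\<close> only the curve is present. By Janiszewski's theorem two nearby
  points on the same side of the curve lie in the same component, so a component at \<open>m\<close>
  is determined by the truth value of "lies inside the curve". In the application \<open>K\<close>
  is the drawing without one edge and overlaps the curve in the remaining edges of a cycle.\<close>

lemma components_at_point_of_simple_closed_curve:
  fixes K :: "complex set"
  assumes K: "compact K" and c: "simple_path c" "pathfinish c = pathstart c"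
    and con: "connected (K \<inter> path_image c)" and m: "m \<in> path_image c" "m \<notin> K"
  shows "finite {F \<in> components (- (K \<union> path_image c)). m \<in> frontier F}"
    and "card {F \<in> components (- (K \<union> path_image c)). m \<in> frontier F} \<le> 2"
proof -
  let ?S = "{F \<in> components (- (K \<union> path_image c)). m \<in> frontier F}"
  let ?f = "\<lambda>F. F \<subseteq> inside (path_image c)"
  note J = Jordan_inside_outside[OF c]
  have "open (- K)" using K by (simp add: compact_imp_closed open_Compl)
  then obtain r where r: "r > 0" "ball m r \<subseteq> - K"
    using m open_contains_ball by (metis ComplI)
  have meets: "\<exists>x \<in> F. x \<in> ball m r" if "F \<in> ?S" for F
    using that r frontier_meets_ball by blast
  have side: "F \<subseteq> inside (path_image c) \<or> F \<subseteq> outside (path_image c)" if "F \<in> ?S" for F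
  proof -
    have "connected F" using that in_components_connected by blast
    moreover have "F \<subseteq> - path_image c" using that in_components_subset by fastforce
    then have "F \<subseteq> inside (path_image c) \<union> outside (path_image c)" using J by simp
    ultimately show ?thesis
      using connectedD[of F "inside (path_image c)" "outside (path_image c)"] J by blast
  qed
  have inj: "inj_on ?f ?S"
  proof (rule inj_onI)
    fix F1 F2 assume F: "F1 \<in> ?S" "F2 \<in> ?S" "?f F1 = ?f F2"
    obtain x y where x: "x \<in> F1" "x \<in> ball m r" and y: "y \<in> F2" "y \<in> ball m r"
      using meets F by meson
    obtain T where T: "connected T" "T \<subseteq> - path_image c" "F1 \<subseteq> T" "F2 \<subseteq> T"
    proof (cases "?f F1")
      case True
      then show ?thesis using that[of "inside (path_image c)"] F J by blast
    next
      case False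
      then have "F1 \<subseteq> outside (path_image c)" "F2 \<subseteq> outside (path_image c)" using F side by blast+
      then show ?thesis using that[of "outside (path_image c)"] J by blast
    qed
    \<comment> \<open>\<open>K\<close> does not separate the points because both lie in the disc,
      and the curve does not because both lie in \<open>T\<close>; the intersection of the two
      closed sets being connected, their union does not separate them either.\<close>
    have "connected_component (- (K \<union> path_image c)) x y"
    proof (rule Janiszewski)
      show "compact K" by fact
      show "closed (path_image c)" using c(1) by (simp add: closed_simple_path_image)
      show "connected (K \<inter> path_image c)" by fact
      show "connected_component (- K) x y"
        unfolding connected_component_def using r x y by (meson connected_ball)
      show "connected_component (- path_image c) x y"
        unfolding connected_component_def using T x y by blast
    qed
    then show "F1 = F2" using F x y
      by (metis (no_types, lifting) components_iff connected_component_eq mem_Collect_eq)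
  qed
  have fin: "finite (?f ` ?S)" by simp
  show "finite ?S" using inj fin finite_image_iff by blast
  have "card ?S = card (?f ` ?S)" using inj by (simp add: card_image)
  also have "\<dots> \<le> card (UNIV :: bool set)" by (rule card_mono) auto
  finally show "card ?S \<le> 2" by simp
qed

section \<open>The upper bound\<close>

lemma cycle4_iff:
  "pre_digraph.cycle (with_proj G) es \<and> length es = 4 \<longleftrightarrow>
     (\<exists>a b c d. es = [(a,b),(b,c),(c,d),(d,a)] \<and> distinct [a,b,c,d] \<and> a \<in> pverts G \<and> set es \<subseteq> parcs G)"
    (is "?L = ?R")
proof
  assume L: ?L
  then obtain e1 e2 e3 e4 where es: "es = [e1,e2,e3,e4]"
    by (auto simp: numeral_eq_Suc length_Suc_conv)
  obtain a b c d where "e1 = (a, b)" "e2 = (b, c)" "e3 = (c, d)" "e4 = (d, a)"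
    using L unfolding es pre_digraph.cycle_def pre_digraph.awalk_def cas_with_proj_eq awalk_verts_with_proj_eq
    by (cases e1; cases e2; cases e3; cases e4) auto
  then show ?R using L
    unfolding es pre_digraph.cycle_def pre_digraph.awalk_def cas_with_proj_eq awalk_verts_with_proj_eq
    by auto
next
  assume ?R
  then show ?L
    unfolding pre_digraph.cycle_def pre_digraph.awalk_def cas_with_proj_eq awalk_verts_with_proj_eq
    by auto
qed

lemma bounded_by_4_cycle_iff:
  assumes "pair_wf_digraph G"
  shows "bounded_by_4_cycle G \<gamma> F \<longleftrightarrow>
     (\<exists>a b c d. distinct [a,b,c,d] \<and> {(a,b),(b,c),(c,d),(d,a)} \<subseteq> parcs G \<and>
        frontier F = path_image (\<gamma> (a,b)) \<union> path_image (\<gamma> (b,c)) \<union> path_image (\<gamma> (c,d)) \<union> path_image (\<gamma> (d,a)))"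
    (is "?L = ?R")
proof
  assume ?L
  then obtain es where "pre_digraph.cycle (with_proj G) es \<and> length es = 4"
    "frontier F = (\<Union>e\<in>set es. path_image (\<gamma> e))"
    unfolding bounded_by_4_cycle_def by blast
  then show ?R unfolding cycle4_iff by (elim exE conjE) (simp add: Un_assoc, blast)
next
  assume ?R
  then obtain a b c d where h: "distinct [a,b,c,d]" "{(a,b),(b,c),(c,d),(d,a)} \<subseteq> parcs G"
    "frontier F = path_image (\<gamma> (a,b)) \<union> path_image (\<gamma> (b,c)) \<union> path_image (\<gamma> (c,d)) \<union> path_image (\<gamma> (d,a))"
    by blast
  have "a \<in> pverts G" using h assms by (auto simp: pair_wf_digraph.in_arcsD1)
  then have "pre_digraph.cycle (with_proj G) [(a,b),(b,c),(c,d),(d,a)] \<and> length [(a,b),(b,c),(c,d),(d,a)] = 4"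
    unfolding cycle4_iff using h by auto
  then show ?L unfolding bounded_by_4_cycle_def using h(3)
    by (intro exI[of _ "[(a,b),(b,c),(c,d),(d,a)]"]) auto
qed

text \<open>The arcs are symmetric already, so \<open>mk_symmetric\<close> adds nothing, and a walk
  along arcs that starts at a vertex stays in \<open>pverts G\<close>, so the restricted closure
  agrees with the ordinary one.\<close>

lemma connected_iff_rtrancl:
  assumes "pair_graph G"
  shows "Digraph_Component.connected (with_proj G) \<longleftrightarrow>
     pverts G \<noteq> {} \<and> (\<forall>u\<in>pverts G. \<forall>v\<in>pverts G. (u, v) \<in> (parcs G)\<^sup>*)"
proof -
  interpret pair_graph G by fact
  have sym: "mk_symmetric (with_proj G) = \<lparr>pverts = pverts G, parcs = parcs G\<rparr>"
    unfolding mk_symmetric_def using arcs_symmetric by auto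
  have "(u, v) \<in> rtrancl_on (pverts G) (parcs G) \<longleftrightarrow> (u, v) \<in> (parcs G)\<^sup>*"
    if "u \<in> pverts G" "v \<in> pverts G" for u v
  proof
    assume "(u, v) \<in> rtrancl_on (pverts G) (parcs G)"
    then show "(u, v) \<in> (parcs G)\<^sup>*" by (induction rule: rtrancl_on_induct) auto
  next
    assume "(u, v) \<in> (parcs G)\<^sup>*"
    then show "(u, v) \<in> rtrancl_on (pverts G) (parcs G)"
    proof induction
      case base show ?case using that by simp
    next
      case (step y z)
      then show ?case by (meson in_arcsD1 in_arcsD2 rtrancl_on_into_rtrancl_on)
    qed
  qed
  then show ?thesis
    unfolding Digraph_Component.connected_def strongly_connected_def reachable_def sym by simp
qed

lemma out_degree_with_proj: "out_degree (with_proj G) v = card {e \<in> parcs G. fst e = v}"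
  by (simp add: out_degree_def out_arcs_def)

text \<open>The arcs leaving \<open>I\<close> number at least \<open>d * card I\<close>, the arcs
  entering \<open>I\<close> are their reversals, and by independence no arc does both.\<close>

lemma card_d_independent_set_le_arcs:
  assumes "pair_graph G" "d_independent_set d G I"
  shows "2 * d * card I \<le> card (parcs G)"
proof -
  interpret pair_graph G by fact
  have I: "I \<subseteq> pverts G" and ind: "\<And>u v. u \<in> I \<Longrightarrow> v \<in> I \<Longrightarrow> (u, v) \<notin> parcs G"
    and deg: "\<And>v. v \<in> I \<Longrightarrow> d \<le> card {e \<in> parcs G. fst e = v}"
    using assms unfolding d_independent_set_def independent_set_def out_degree_with_proj by auto
  have finI: "finite I" using I pair_finite_verts finite_subset by blast
  define Out where "Out = {e \<in> parcs G. fst e \<in> I}"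
  define In where "In = {e \<in> parcs G. snd e \<in> I}"
  have "Out = (\<Union>v\<in>I. {e \<in> parcs G. fst e = v})" unfolding Out_def by auto
  also have "card \<dots> = (\<Sum>v\<in>I. card {e \<in> parcs G. fst e = v})"
    using finI pair_finite_arcs by (intro card_UN_disjoint) auto
  finally have "card I * d \<le> card Out" using sum_mono[of I "\<lambda>_. d", OF deg] by simp
  moreover have "In = prod.swap ` Out"
    unfolding In_def Out_def using arcs_symmetric by (force simp: image_iff)
  then have "card In = card Out" by (simp add: card_image)
  moreover have "card (Out \<union> In) = card Out + card In"
    using pair_finite_arcs ind by (intro card_Un_disjoint) (auto simp: Out_def In_def)
  moreover have "card (Out \<union> In) \<le> card (parcs G)"
    using pair_finite_arcs by (intro card_mono) (auto simp: Out_def In_def)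
  ultimately show ?thesis by (simp add: algebra_simps)
qed

section \<open>Euler's inequality and the double count of faces for a fixed drawing\<close>

locale plane_graph = pair_graph G for G :: "'a pair_pre_digraph" +
  fixes p :: "'a \<Rightarrow> complex" and \<gamma> :: "'a \<times> 'a \<Rightarrow> real \<Rightarrow> complex"
  assumes drawing: "plane_drawing G p \<gamma>"
begin

lemma edge:
  assumes "(u, v) \<in> parcs G"
  shows "Path_Connected.arc (\<gamma> (u, v))" "pathstart (\<gamma> (u, v)) = p u" "pathfinish (\<gamma> (u, v)) = p v"
    "\<gamma> (v, u) = reversepath (\<gamma> (u, v))" "path_image (\<gamma> (u, v)) \<inter> p ` pverts G = {p u, p v}"
  using drawing assms by (auto simp: plane_drawing_def)

lemma edge_Int:
  assumes "(u, v) \<in> parcs G" "(x, y) \<in> parcs G" "{u, v} \<noteq> {x, y}"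
  shows "path_image (\<gamma> (u, v)) \<inter> path_image (\<gamma> (x, y)) = p ` ({u, v} \<inter> {x, y})"
  using drawing assms unfolding plane_drawing_def by blast

lemma ends_in_edge: "(u, v) \<in> parcs G \<Longrightarrow> p u \<in> path_image (\<gamma> (u, v))"
  "(u, v) \<in> parcs G \<Longrightarrow> p v \<in> path_image (\<gamma> (u, v))"
  using edge(5) by blast+

lemma edge_image_swap: "(u, v) \<in> parcs G \<Longrightarrow> path_image (\<gamma> (v, u)) = path_image (\<gamma> (u, v))"
  by (simp add: edge(4))

lemma edge_Int_subgraph:
  assumes e: "(u, v) \<in> parcs G" and V: "V \<subseteq> pverts G" and A: "A \<subseteq> parcs G"
    and n: "(u, v) \<notin> A" "(v, u) \<notin> A"
  shows "path_image (\<gamma> (u, v)) \<inter> (p ` V \<union> (\<Union>e\<in>A. path_image (\<gamma> e))) \<subseteq> {p u, p v}"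
proof -
  have "path_image (\<gamma> (u, v)) \<inter> p ` V \<subseteq> {p u, p v}" using edge(5)[OF e] V by blast
  moreover have "path_image (\<gamma> (u, v)) \<inter> path_image (\<gamma> (x, y)) \<subseteq> {p u, p v}" if "(x, y) \<in> A" for x y
  proof -
    have "{u, v} \<noteq> {x, y}" using that n by (auto simp: doubleton_eq_iff)
    then show ?thesis using edge_Int[OF e, of x y] that A by blast
  qed
  then have "path_image (\<gamma> (u, v)) \<inter> path_image (\<gamma> e) \<subseteq> {p u, p v}" if "e \<in> A" for e
    using that by (cases e) simp
  ultimately show ?thesis by blast
qed

lemma compact_subgraph_image:
  assumes "V \<subseteq> pverts G" "A \<subseteq> parcs G"
  shows "compact (p ` V \<union> (\<Union>e\<in>A. path_image (\<gamma> e)))"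
proof -
  have "finite V" "finite A" using assms pair_finite_verts pair_finite_arcs finite_subset by blast+
  moreover have "compact (path_image (\<gamma> e))" if "e \<in> A" for e
    using that assms edge(1)[of "fst e" "snd e"] by (auto simp: compact_arc_image)
  ultimately show ?thesis by (intro compact_Un compact_UN) (auto intro: finite_imp_compact)
qed

text \<open>The half of Euler's formula that holds for the drawing of any connected subgraph: an arc to
  a new vertex does not decrease the number of faces, and an arc between old vertices splits one.\<close>

definition euler_subgraph :: "'a set \<Rightarrow> 'a rel \<Rightarrow> bool" where
  "euler_subgraph V A \<longleftrightarrow> V \<subseteq> pverts G \<and> A \<subseteq> parcs G \<and> A \<subseteq> V \<times> V \<and> sym A \<and> V \<noteq> {} \<and>
     path_connected (p ` V \<union> (\<Union>e\<in>A. path_image (\<gamma> e))) \<and>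
     (\<exists>\<F>. finite \<F> \<and> \<F> \<subseteq> components (- (p ` V \<union> (\<Union>e\<in>A. path_image (\<gamma> e)))) \<and>
          card A + 4 \<le> 2 * card \<F> + 2 * card V)"

text \<open>The induction starts with equality: no arcs, one vertex and one face give $0 + 4 = 2 +
  2$.\<close>

lemma euler_subgraph_singleton:
  assumes "v \<in> pverts G"
  shows "euler_subgraph {v} {}"
proof -
  have "- {p v} \<noteq> {}"
    by (metis Compl_empty_eq double_complement finite.emptyI finite.insertI infinite_UNIV_char_0)
  then obtain F where "F \<in> components (- {p v})" using components_eq_empty by blast
  then show ?thesis
    unfolding euler_subgraph_def using assms
    by (intro conjI exI[of _ "{F}"]) (auto simp: sym_def)
qed

text \<open>The arc count grows by 2. If \<open>v\<close> is new, so does the vertex term, and every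
  old face still contains a new one. If \<open>v\<close> is old, one additional face has to be
  found, and the chord lemma supplies it.\<close>

lemma euler_subgraph_extend:
  assumes H: "euler_subgraph V A" and e: "(u, v) \<in> parcs G" and u: "u \<in> V" and n: "(u, v) \<notin> A"
  shows "euler_subgraph (insert v V) (A \<union> {(u, v), (v, u)})"
proof -
  define X where "X = p ` V \<union> (\<Union>e\<in>A. path_image (\<gamma> e))"
  define X' where "X' = p ` insert v V \<union> (\<Union>e\<in>A \<union> {(u, v), (v, u)}. path_image (\<gamma> e))"
  from H obtain \<F> where V: "V \<subseteq> pverts G" and A: "A \<subseteq> parcs G" "A \<subseteq> V \<times> V" "sym A"
    and pc: "path_connected X" and \<F>: "finite \<F>" "\<F> \<subseteq> components (- X)"
    and le: "card A + 4 \<le> 2 * card \<F> + 2 * card V"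
    unfolding euler_subgraph_def X_def[symmetric] by blast
  have n': "(v, u) \<notin> A" using n A(3) by (auto simp: sym_def)
  have uv: "u \<noteq> v" using e no_loops' by blast
  have fin: "finite V" "finite A"
    using V A pair_finite_verts pair_finite_arcs finite_subset by blast+
  note g = edge[OF e]
  have X': "X' = X \<union> path_image (\<gamma> (u, v))"
    unfolding X'_def X_def using edge_image_swap[OF e] ends_in_edge[OF e] by auto
  have X: "compact X" unfolding X_def using V A(1) by (rule compact_subgraph_image)
  have Int: "path_image (\<gamma> (u, v)) \<inter> X \<subseteq> {p u, p v}"
    unfolding X_def using e V A(1) n n' by (rule edge_Int_subgraph)
  have pu: "p u \<in> X" unfolding X_def using u by blast
  have pc': "path_connected X'"
    unfolding X' using pc g(1) pu ends_in_edge[OF e]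
    by (intro path_connected_Un) (auto simp: path_connected_path_image arc_imp_path)
  \<comment> \<open>\<open>h\<close> selects one new face inside each old face; distinct old faces
    are disjoint, so the selection is injective.\<close>
  have "\<forall>U \<in> components (- X). \<exists>W. W \<in> components (- X') \<and> W \<subseteq> U"
    unfolding X' using component_Un_arc_subset[OF compact_imp_closed[OF X] g(1)] by blast
  from bchoice[OF this] obtain h where h: "\<And>U. U \<in> components (- X) \<Longrightarrow> h U \<in> components (- X')"
    "\<And>U. U \<in> components (- X) \<Longrightarrow> h U \<subseteq> U" by blast
  have same: "U = U'" if "U \<in> components (- X)" "U' \<in> components (- X)"
    "W \<in> components (- X')" "W \<subseteq> U" "W \<subseteq> U'" for U U' W
  proof -
    have "U \<inter> U' \<noteq> {}" using that in_components_nonempty[OF that(3)] by blast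
    then show ?thesis using components_eq[OF that(1,2)] by simp
  qed
  have inj: "inj_on h \<F>"
  proof (rule inj_onI)
    fix U U' assume U: "U \<in> \<F>" "U' \<in> \<F>" "h U = h U'"
    then have "U \<in> components (- X)" "U' \<in> components (- X)" using \<F>(2) by auto
    then show "U = U'" using same[of U U' "h U"] h[of U] h[of U'] U(3) by simp
  qed
  have cA: "card (A \<union> {(u, v), (v, u)}) = card A + 2"
    using fin n n' uv by (simp add: card_insert_if)
  have "\<exists>\<F>'. finite \<F>' \<and> \<F>' \<subseteq> components (- X') \<and>
     card (A \<union> {(u, v), (v, u)}) + 4 \<le> 2 * card \<F>' + 2 * card (insert v V)"
  proof (cases "v \<in> V")
    case False
    have "card (h ` \<F>) = card \<F>" using inj by (rule card_image)
    then show ?thesis using \<F> h(1) le cA False fin by (intro exI[of _ "h ` \<F>"]) auto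
  next
    case True
    then have "p v \<in> X" unfolding X_def by blast
    then have "X \<inter> path_image (\<gamma> (u, v)) = {pathstart (\<gamma> (u, v)), pathfinish (\<gamma> (u, v))}"
      using Int pu ends_in_edge[OF e] g by auto
    from component_split_by_chord[OF X pc g(1) this]
    obtain U W1 W2 where U: "U \<in> components (- X)" and W: "W1 \<in> components (- X')" "W2 \<in> components (- X')"
      "W1 \<noteq> W2" "W1 \<subseteq> U" "W2 \<subseteq> U" unfolding X' by blast
    \<comment> \<open>Of the two pieces of \<open>U\<close>, at most one is the selected face
      \<open>h U\<close>. The other one is new to the family, whether or not \<open>U\<close> itself
      belongs to \<open>\<F>\<close>.\<close>
    obtain W where W: "W \<in> components (- X')" "W \<subseteq> U" "W \<noteq> h U" using W by metis
    have "W \<notin> h ` \<F>"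
    proof
      assume "W \<in> h ` \<F>"
      then obtain U' where U': "U' \<in> \<F>" "W = h U'" by blast
      then have "U' = U" using same[of U' U W] \<F>(2) U W h by blast
      then show False using U' W by simp
    qed
    then have "card (insert W (h ` \<F>)) = card \<F> + 1"
      using card_image[OF inj] \<F>(1) by simp
    then show ?thesis using \<F> h(1) le cA True fin W(1)
      by (intro exI[of _ "insert W (h ` \<F>)"]) (auto simp: insert_absorb)
  qed
  moreover have "sym (A \<union> {(u, v), (v, u)})" using A(3) by (auto simp: sym_def)
  ultimately show ?thesis
    unfolding euler_subgraph_def X'_def[symmetric]
    using V A e u arcs_symmetric[OF e] in_arcsD2[OF e] pc' by blast
qed

text \<open>Among all subgraphs satisfying the invariant, one with the largest number of arcs is
  taken. It contains every arc that starts in it, for otherwise \<open>euler_subgraph_extend\<close>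
  would enlarge it; connectedness makes it the whole graph.\<close>

lemma euler_subgraph_full:
  assumes "Digraph_Component.connected (with_proj G)"
  shows "euler_subgraph (pverts G) (parcs G)"
proof -
  have ne: "pverts G \<noteq> {}" and conn: "\<And>u v. u \<in> pverts G \<Longrightarrow> v \<in> pverts G \<Longrightarrow> (u, v) \<in> (parcs G)\<^sup>*"
    using assms connected_iff_rtrancl[OF pair_graph] by auto
  define P where "P k \<longleftrightarrow> (\<exists>V A. euler_subgraph V A \<and> card A = k)" for k
  obtain v0 where "v0 \<in> pverts G" using ne by blast
  then have "P 0" unfolding P_def using euler_subgraph_singleton by fastforce
  moreover have bound: "k \<le> card (parcs G)" if "P k" for k
    using that unfolding P_def euler_subgraph_def by (auto intro: card_mono pair_finite_arcs)
  ultimately obtain k where k: "P k" "\<And>j. P j \<Longrightarrow> j \<le> k"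
    using Nat.ex_has_greatest_nat[of P 0 "card (parcs G)"] by blast
  then obtain V A where VA: "euler_subgraph V A" "card A = k" unfolding P_def by blast
  then have V: "V \<subseteq> pverts G" "V \<noteq> {}" and A: "A \<subseteq> parcs G" "A \<subseteq> V \<times> V"
    unfolding euler_subgraph_def by auto
  have finA: "finite A" using A pair_finite_arcs finite_subset by blast
  have all: "(u, v) \<in> A" if "(u, v) \<in> parcs G" "u \<in> V" for u v
  proof (rule ccontr)
    assume n: "(u, v) \<notin> A"
    have "euler_subgraph (insert v V) (A \<union> {(u, v), (v, u)})"
      using euler_subgraph_extend VA(1) that n by blast
    then have "card (A \<union> {(u, v), (v, u)}) \<le> k" using k(2) P_def by blast
    moreover have "card A < card (A \<union> {(u, v), (v, u)})"
      using finA n by (intro psubset_card_mono) auto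
    ultimately show False using VA(2) by simp
  qed
  obtain w where w: "w \<in> V" using V by blast
  have "v \<in> V" if "v \<in> pverts G" for v
  proof -
    have "(w, v) \<in> (parcs G)\<^sup>*" using conn w V that by blast
    then show ?thesis by induction (use w all A in blast)+
  qed
  then have "V = pverts G" using V by blast
  moreover from this have "A = parcs G" using all A in_arcsD1 by fast
  ultimately show ?thesis using VA by simp
qed

text \<open>Finiteness is assumed because the invariant only provides a finite subfamily of the
  faces, and its size bounds \<open>card\<close> of all faces from below only if they are finite in
  number. \<open>quadrangulation_faces\<close> discharges the assumption.\<close>

corollary euler_inequality:
  assumes "Digraph_Component.connected (with_proj G)" "finite (drawing_faces G p \<gamma>)"
  shows "card (parcs G) + 4 \<le> 2 * card (drawing_faces G p \<gamma>) + 2 * card (pverts G)"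
proof -
  obtain \<F> where \<F>: "\<F> \<subseteq> drawing_faces G p \<gamma>" "card (parcs G) + 4 \<le> 2 * card \<F> + 2 * card (pverts G)"
    using euler_subgraph_full[OF assms(1)]
    unfolding euler_subgraph_def drawing_faces_def drawing_image_def by blast
  then show ?thesis using card_mono[OF assms(2) \<F>(1)] by linarith
qed

text \<open>With \<open>K\<close> the drawing minus the edge \<open>ab\<close> and \<open>z\<close>
  the closed curve of the 4-cycle, \<open>K\<close> meets \<open>z\<close> in the arc
  \<open>h\<close> formed by the other three edges, which is connected. The bound at the midpoint of
  \<open>ab\<close> therefore applies, and a frontier containing the edge contains its
  midpoint.\<close>

lemma faces_at_cycle_edge:
  assumes dist: "distinct [a, b, c, d]" and cyc: "{(a, b), (b, c), (c, d), (d, a)} \<subseteq> parcs G"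
  defines "S \<equiv> {F \<in> drawing_faces G p \<gamma>. path_image (\<gamma> (a, b)) \<subseteq> frontier F}"
  shows "finite S" "card S \<le> 2"
proof -
  have e: "(a, b) \<in> parcs G" "(b, c) \<in> parcs G" "(c, d) \<in> parcs G" "(d, a) \<in> parcs G"
    using cyc by auto
  define K where "K = p ` pverts G \<union> (\<Union>e\<in>parcs G - {(a, b), (b, a)}. path_image (\<gamma> e))"
  define h where "h = \<gamma> (b, c) +++ \<gamma> (c, d) +++ \<gamma> (d, a)"
  define z where "z = \<gamma> (a, b) +++ h"
  have K: "compact K" unfolding K_def by (rule compact_subgraph_image) auto
  have abK: "path_image (\<gamma> (a, b)) \<inter> K \<subseteq> {p a, p b}"
    unfolding K_def by (rule edge_Int_subgraph[OF e(1)]) auto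
  have I1: "path_image (\<gamma> (c, d)) \<inter> path_image (\<gamma> (d, a)) = {p d}"
    using edge_Int[OF e(3,4)] dist by (auto simp: doubleton_eq_iff)
  have I2: "path_image (\<gamma> (b, c)) \<inter> path_image (\<gamma> (c, d)) = {p c}"
    using edge_Int[OF e(2,3)] dist by (auto simp: doubleton_eq_iff)
  have I3: "path_image (\<gamma> (b, c)) \<inter> path_image (\<gamma> (d, a)) = {}"
    using edge_Int[OF e(2,4)] dist by (auto simp: doubleton_eq_iff)
  have h1: "Path_Connected.arc (\<gamma> (c, d) +++ \<gamma> (d, a))"
    using edge(1-3)[OF e(3)] edge(1-3)[OF e(4)] I1 by (intro arc_join) simp_all
  have h: "Path_Connected.arc h" unfolding h_def
  proof (rule arc_join[OF _ h1])
    show "path_image (\<gamma> (b, c)) \<inter> path_image (\<gamma> (c, d) +++ \<gamma> (d, a)) \<subseteq> {pathstart (\<gamma> (c, d) +++ \<gamma> (d, a))}"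
      using edge(2,3)[OF e(3)] edge(2,3)[OF e(4)] I2 I3 by (simp add: path_image_join Int_Un_distrib)
  qed (use edge(1-3)[OF e(2)] edge(2)[OF e(3)] in simp_all)
  have him: "path_image h = path_image (\<gamma> (b, c)) \<union> path_image (\<gamma> (c, d)) \<union> path_image (\<gamma> (d, a))"
    unfolding h_def using edge[OF e(2)] edge[OF e(3)] edge[OF e(4)] by (simp add: path_image_join Un_assoc)
  have hends: "pathstart h = p b" "pathfinish h = p a"
    unfolding h_def using edge[OF e(2)] edge[OF e(4)] by simp_all
  have "(b, c) \<in> parcs G - {(a, b), (b, a)}" "(c, d) \<in> parcs G - {(a, b), (b, a)}"
    "(d, a) \<in> parcs G - {(a, b), (b, a)}" using e dist by auto
  then have hK: "path_image h \<subseteq> K" unfolding him K_def by blast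
  have ab: "pathstart (\<gamma> (a, b)) = p a" "pathfinish (\<gamma> (a, b)) = p b" "Path_Connected.arc (\<gamma> (a, b))"
    using edge[OF e(1)] by auto
  have z: "simple_path z" "pathfinish z = pathstart z"
  proof -
    show "simple_path z" unfolding z_def
      by (rule simple_path_join_loop) (use h hends ab abK hK in \<open>simp_all, blast\<close>)
    show "pathfinish z = pathstart z" unfolding z_def using hends ab by simp
  qed
  have zim: "path_image z = path_image (\<gamma> (a, b)) \<union> path_image h"
    unfolding z_def using hends ab by (simp add: path_image_join)
  have "K \<inter> path_image z = path_image h"
    using abK hK hends pathstart_in_path_image[of h] pathfinish_in_path_image[of h] unfolding zim by auto
  then have con: "connected (K \<inter> path_image z)" using h by (simp add: connected_arc_image)
  have "drawing_image G p \<gamma> = K \<union> path_image (\<gamma> (a, b))"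
    unfolding drawing_image_def K_def using edge_image_swap[OF e(1)] e(1) by auto
  then have X: "drawing_image G p \<gamma> = K \<union> path_image z" using hK zim by auto
  define m where "m = \<gamma> (a, b) (1/2)"
  have m: "m \<in> path_image (\<gamma> (a, b))" "m \<notin> {p a, p b}"
    unfolding m_def using arc_midpoint[OF ab(3)] ab by auto
  note main = components_at_point_of_simple_closed_curve[OF K z con, of m]
  have sub: "S \<subseteq> {F \<in> components (- (K \<union> path_image z)). m \<in> frontier F}"
    unfolding S_def drawing_faces_def X using m by auto
  have m': "m \<in> path_image z" "m \<notin> K" using m abK zim by auto
  show "finite S" by (rule finite_subset[OF sub main(1)[OF m']])
  show "card S \<le> 2" by (rule order_trans[OF card_mono[OF main(1)[OF m'] sub] main(2)[OF m']])
qed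

text \<open>Incidences between faces and arcs are counted twice: an arc lies on the frontier of at
  most 2 faces, while a face has 4 boundary edges, hence at least 8 arcs. So $8f$ is at most twice
  the number of arcs.\<close>

lemma quadrangulation_faces:
  assumes quad: "\<And>F. F \<in> drawing_faces G p \<gamma> \<Longrightarrow> bounded_by_4_cycle G \<gamma> F"
  shows "finite (drawing_faces G p \<gamma>)" "4 * card (drawing_faces G p \<gamma>) \<le> card (parcs G)"
proof -
  let ?\<F> = "drawing_faces G p \<gamma>"
  let ?R = "\<lambda>F e. path_image (\<gamma> e) \<subseteq> frontier F"
  have wf: "pair_wf_digraph G" by unfold_locales
  have at_arc: "finite {F \<in> ?\<F>. ?R F e} \<and> card {F \<in> ?\<F>. ?R F e} \<le> 2" if e: "e \<in> parcs G" for e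
  proof (cases "{F \<in> ?\<F>. ?R F e} = {}")
    case True
    show ?thesis unfolding True by simp
  next
    case False
    then obtain F where F: "F \<in> ?\<F>" "?R F e" by blast
    obtain u v where uv: "e = (u, v)" by fastforce
    obtain a b c d where abcd: "distinct [a,b,c,d]" "{(a,b),(b,c),(c,d),(d,a)} \<subseteq> parcs G"
      "frontier F = path_image (\<gamma> (a,b)) \<union> path_image (\<gamma> (b,c)) \<union> path_image (\<gamma> (c,d)) \<union> path_image (\<gamma> (d,a))"
      using quad[OF F(1)] bounded_by_4_cycle_iff[OF wf] by blast
    \<comment> \<open>Distinct edges meet only in common end vertices, so the midpoint identifies
      the edge: the boundary cycle of \<open>F\<close> must itself run through \<open>e\<close>, in
      one direction or the other.\<close>
    define m where "m = \<gamma> e (1/2)"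
    have m: "m \<in> path_image (\<gamma> (u, v))" "m \<noteq> p u" "m \<noteq> p v"
      using arc_midpoint[of "\<gamma> e"] edge[of u v] e unfolding m_def uv by auto
    have "m \<in> frontier F" using F(2) m(1) uv by auto
    then have "\<exists>x y. (x, y) \<in> {(a,b),(b,c),(c,d),(d,a)} \<and> m \<in> path_image (\<gamma> (x, y))"
      unfolding abcd(3) by (elim UnE) blast+
    then obtain x y where xy: "(x, y) \<in> {(a,b),(b,c),(c,d),(d,a)}" "m \<in> path_image (\<gamma> (x, y))"
      by blast
    have xyG: "(x, y) \<in> parcs G" using xy(1) abcd(2) by blast
    have "{u, v} = {x, y}"
    proof (rule ccontr)
      assume "{u, v} \<noteq> {x, y}"
      then have "path_image (\<gamma> (u, v)) \<inter> path_image (\<gamma> (x, y)) = p ` ({u, v} \<inter> {x, y})"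
        using edge_Int[of u v x y] xyG e uv by simp
      then have "m \<in> p ` ({u, v} \<inter> {x, y})" using m(1) xy(2) by blast
      then show False using m by blast
    qed
    then have "path_image (\<gamma> e) = path_image (\<gamma> (x, y))"
      using edge_image_swap[OF xyG] uv by (auto simp: doubleton_eq_iff)
    moreover have "finite {F \<in> ?\<F>. ?R F (x, y)} \<and> card {F \<in> ?\<F>. ?R F (x, y)} \<le> 2"
    proof -
      \<comment> \<open>A cyclic shift of the boundary cycle makes \<open>(x, y)\<close> its leading
        edge, the form that \<open>faces_at_cycle_edge\<close> handles.\<close>
      have "\<exists>c' d'. distinct [x, y, c', d'] \<and> {(x, y), (y, c'), (c', d'), (d', x)} \<subseteq> parcs G"
      proof -
        consider "(x, y) = (a, b)" | "(x, y) = (b, c)" | "(x, y) = (c, d)" | "(x, y) = (d, a)"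
          using xy(1) by blast
        then show ?thesis
        proof cases
          case 1
          then show ?thesis using abcd(1,2) by (intro exI[of _ c] exI[of _ d]) auto
        next
          case 2
          then show ?thesis using abcd(1,2) by (intro exI[of _ d] exI[of _ a]) auto
        next
          case 3
          then show ?thesis using abcd(1,2) by (intro exI[of _ a] exI[of _ b]) auto
        next
          case 4
          then show ?thesis using abcd(1,2) by (intro exI[of _ b] exI[of _ c]) auto
        qed
      qed
      then obtain c' d' where "distinct [x, y, c', d']" "{(x, y), (y, c'), (c', d'), (d', x)} \<subseteq> parcs G"
        by blast
      from faces_at_cycle_edge[OF this] show ?thesis ..
    qed
    ultimately show ?thesis by simp
  qed
  have at_face: "8 \<le> card {e \<in> parcs G. ?R F e}" if F: "F \<in> ?\<F>" for F
  proof -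
    obtain a b c d where abcd: "distinct [a,b,c,d]" "{(a,b),(b,c),(c,d),(d,a)} \<subseteq> parcs G"
      "frontier F = path_image (\<gamma> (a,b)) \<union> path_image (\<gamma> (b,c)) \<union> path_image (\<gamma> (c,d)) \<union> path_image (\<gamma> (d,a))"
      using quad[OF F] bounded_by_4_cycle_iff[OF wf] by blast
    let ?E = "{(a,b),(b,c),(c,d),(d,a),(b,a),(c,b),(d,c),(a,d)}"
    have e: "(a, b) \<in> parcs G" "(b, c) \<in> parcs G" "(c, d) \<in> parcs G" "(d, a) \<in> parcs G"
      using abcd(2) by auto
    have "?E \<subseteq> parcs G" using e e[THEN arcs_symmetric] by simp
    moreover have "?R F e" if "e \<in> ?E" for e
      using that e[THEN edge_image_swap] unfolding abcd(3) by (elim insertE emptyE) auto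
    ultimately have sub: "?E \<subseteq> {e \<in> parcs G. ?R F e}" by blast
    have "card ?E = 8"
      using abcd(1) distinct_card[of "[(a,b),(b,c),(c,d),(d,a),(b,a),(c,b),(d,c),(a,d)]"] by auto
    moreover have "finite {e \<in> parcs G. ?R F e}" using pair_finite_arcs by simp
    note card_mono[OF this sub]
    ultimately show ?thesis by simp
  qed
  \<comment> \<open>Finiteness of the set of faces: each face occurs at some arc, and each of the
    finitely many arcs has finitely many faces.\<close>
  have "?\<F> \<subseteq> (\<Union>e\<in>parcs G. {F \<in> ?\<F>. ?R F e})"
  proof
    fix F assume "F \<in> ?\<F>"
    then have "card {e \<in> parcs G. ?R F e} \<noteq> 0" using at_face[of F] by linarith
    then have "{e \<in> parcs G. ?R F e} \<noteq> {}" by (metis card.empty)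
    then show "F \<in> (\<Union>e\<in>parcs G. {F \<in> ?\<F>. ?R F e})" using \<open>F \<in> ?\<F>\<close> by blast
  qed
  then show fin: "finite ?\<F>"
    by (rule finite_subset) (simp add: pair_finite_arcs at_arc)
  have "8 * card ?\<F> \<le> (\<Sum>F\<in>?\<F>. card {e \<in> parcs G. ?R F e})"
    using sum_mono[of ?\<F> "\<lambda>_. 8", OF at_face] by (simp add: mult.commute)
  also have "\<dots> = (\<Sum>e\<in>parcs G. card {F \<in> ?\<F>. ?R F e})"
    using fin pair_finite_arcs by (rule sum_multicount_gen) simp
  also have "\<dots> \<le> (\<Sum>e\<in>parcs G. 2)" using at_arc by (intro sum_mono) simp
  finally show "4 * card ?\<F> \<le> card (parcs G)" by simp
qed

end

lemma d_independent_set_upper_bound: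
  assumes "simple_quadrangulated_graph G" "d_independent_set d G I" "d \<ge> 1"
  shows "real (card I) \<le> 2 / real d * (real (card (pverts G)) - 2)"
proof -
  from assms(1) obtain p \<gamma> where G: "pair_graph G" "Digraph_Component.connected (with_proj G)"
    and p: "plane_drawing G p \<gamma>" "\<And>F. F \<in> drawing_faces G p \<gamma> \<Longrightarrow> bounded_by_4_cycle G \<gamma> F"
    unfolding simple_quadrangulated_graph_def quadrangulated_def by blast
  interpret plane_graph G p \<gamma>
    by (intro plane_graph.intro plane_graph_axioms.intro G p)
  \<comment> \<open>With $A$ arcs and $f$ faces, doubling $A + 4 \<le> 2f + 2n$ and inserting $4f
    \<le> A$ gives $A + 8 \<le> 4n$, while $2d|I| \<le> A$.\<close>
  have "2 * d * card I + 8 \<le> 4 * card (pverts G)"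
    using card_d_independent_set_le_arcs[OF G(1) assms(2)] quadrangulation_faces(2)[OF p(2)]
      euler_inequality[OF G(2) quadrangulation_faces(1)[OF p(2)]] by linarith
  then have "real (2 * d * card I + 8) \<le> real (4 * card (pverts G))"
    by (simp only: of_nat_le_iff)
  then have "2 * (real d * real (card I)) + 8 \<le> 4 * real (card (pverts G))" by simp
  then show ?thesis using assms(3) by (simp add: field_simps)
qed

section \<open>Faces parametrised by a diamond\<close>

text \<open>This is the unit ball of the 1-norm. Its corners $1, i, -1, -i$ stand for the corners of
  a quadrangular face, multiplication by $i$ permutes them cyclically, and the diagonal from $i$ to
  $-i$ is the imaginary axis, along which faces get cut.\<close>

definition diamond :: "complex set" where
  "diamond = {z. \<bar>Re z\<bar> + \<bar>Im z\<bar> \<le> 1}"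

definition open_diamond :: "complex set" where
  "open_diamond = {z. \<bar>Re z\<bar> + \<bar>Im z\<bar> < 1}"

lemma open_diamond_subset: "open_diamond \<subseteq> diamond"
  by (auto simp: diamond_def open_diamond_def)

lemma open_open_diamond: "open open_diamond"
  unfolding open_diamond_def by (intro open_Collect_less continuous_intros)

lemma convex_diamonds: "convex diamond" "convex open_diamond"
proof -
  have *: "\<bar>Re (u *\<^sub>R x + v *\<^sub>R y)\<bar> + \<bar>Im (u *\<^sub>R x + v *\<^sub>R y)\<bar>
      \<le> u * (\<bar>Re x\<bar> + \<bar>Im x\<bar>) + v * (\<bar>Re y\<bar> + \<bar>Im y\<bar>)" if "u \<ge> 0" "v \<ge> 0" for u v x y
    using abs_triangle_ineq[of "u * Re x" "v * Re y"] abs_triangle_ineq[of "u * Im x" "v * Im y"] that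
    by (simp add: abs_mult algebra_simps)
  show "convex diamond" unfolding convex_def diamond_def
  proof (clarsimp simp del: plus_complex.sel scaleR_complex.sel)
    fix x y and u v :: real assume h: "\<bar>Re x\<bar> + \<bar>Im x\<bar> \<le> 1" "\<bar>Re y\<bar> + \<bar>Im y\<bar> \<le> 1" "0 \<le> u" "0 \<le> v" "u + v = 1"
    have "u * (\<bar>Re x\<bar> + \<bar>Im x\<bar>) + v * (\<bar>Re y\<bar> + \<bar>Im y\<bar>) \<le> 1"
      using convex_bound_le[of "\<bar>Re x\<bar> + \<bar>Im x\<bar>" 1 "\<bar>Re y\<bar> + \<bar>Im y\<bar>" u v] h by simp
    then show "\<bar>Re (u *\<^sub>R x + v *\<^sub>R y)\<bar> + \<bar>Im (u *\<^sub>R x + v *\<^sub>R y)\<bar> \<le> 1"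
      using *[OF h(3,4)] order_trans by blast
  qed
  show "convex open_diamond" unfolding convex_def open_diamond_def
  proof (clarsimp simp del: plus_complex.sel scaleR_complex.sel)
    fix x y and u v :: real assume h: "\<bar>Re x\<bar> + \<bar>Im x\<bar> < 1" "\<bar>Re y\<bar> + \<bar>Im y\<bar> < 1" "0 \<le> u" "0 \<le> v" "u + v = 1"
    have "u * (\<bar>Re x\<bar> + \<bar>Im x\<bar>) + v * (\<bar>Re y\<bar> + \<bar>Im y\<bar>) < 1"
      using convex_bound_lt[of "\<bar>Re x\<bar> + \<bar>Im x\<bar>" 1 "\<bar>Re y\<bar> + \<bar>Im y\<bar>" u v] h by simp
    then show "\<bar>Re (u *\<^sub>R x + v *\<^sub>R y)\<bar> + \<bar>Im (u *\<^sub>R x + v *\<^sub>R y)\<bar> < 1"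
      using *[OF h(3,4), of x y] by linarith
  qed
qed

lemma compact_diamond: "compact diamond"
proof -
  have "closed diamond" unfolding diamond_def by (intro closed_Collect_le continuous_intros)
  moreover have "norm z \<le> 1" if "z \<in> diamond" for z
    using that cmod_le[of z] by (simp add: diamond_def)
  then have "bounded diamond" by (auto simp: bounded_iff)
  ultimately show ?thesis by (simp add: compact_eq_bounded_closed)
qed

lemma closure_open_diamond: "closure open_diamond = diamond"
proof
  show "closure open_diamond \<subseteq> diamond"
    by (intro closure_minimal open_diamond_subset compact_imp_closed compact_diamond)
  show "diamond \<subseteq> closure open_diamond"
  proof
    fix z assume z: "z \<in> diamond"
    have "(\<lambda>n. (1 - inverse (real (Suc n))) *\<^sub>R z) \<longlonglongrightarrow> (1 - 0) *\<^sub>R z"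
      by (intro tendsto_intros LIMSEQ_inverse_real_of_nat)
    moreover have "(1 - inverse (real (Suc n))) *\<^sub>R z \<in> open_diamond" for n
    proof -
      define t where "t = 1 - inverse (real (Suc n))"
      have t: "0 \<le> t" "t < 1" by (auto simp: t_def field_simps)
      have "\<bar>Re (t *\<^sub>R z)\<bar> + \<bar>Im (t *\<^sub>R z)\<bar> = t * (\<bar>Re z\<bar> + \<bar>Im z\<bar>)"
        using t by (simp add: abs_mult algebra_simps)
      also have "\<dots> \<le> t * 1" using z t by (intro mult_left_mono) (auto simp: diamond_def)
      finally show ?thesis using t unfolding t_def[symmetric] open_diamond_def by simp
    qed
    ultimately show "z \<in> closure open_diamond" unfolding closure_sequential
      by (intro exI[of _ "\<lambda>n. (1 - inverse (real (Suc n))) *\<^sub>R z"]) simp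
  qed
qed

lemma interior_diamond: "interior diamond = open_diamond"
  using convex_interior_closure[OF convex_diamonds(2)] closure_open_diamond open_open_diamond
  by (simp add: interior_open)

text \<open>The signs \<open>s\<close> and \<open>t\<close> select the quadrant, so one computation
  covers all four sides; \<open>t * Im z\<close> is the parameter of \<open>z\<close> on the
  segment.\<close>

lemma closed_segment_diamond_side:
  assumes "\<bar>s\<bar> = 1" "\<bar>t\<bar> = 1"
  shows "closed_segment (complex_of_real s) (Complex 0 t) =
    {z. 0 \<le> s * Re z \<and> 0 \<le> t * Im z \<and> s * Re z + t * Im z = 1}"
proof -
  have st: "s * s = 1" "t * t = 1" using assms by (auto simp: abs_if split: if_splits)
  show ?thesis
  proof (intro set_eqI iffI)
    fix z assume "z \<in> closed_segment (complex_of_real s) (Complex 0 t)"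
    then obtain r where r: "0 \<le> r" "r \<le> 1" "z = (1 - r) *\<^sub>R complex_of_real s + r *\<^sub>R Complex 0 t"
      by (auto simp: in_segment)
    have "s * Re z = (1 - r) * (s * s)" "t * Im z = r * (t * t)" using r by (simp_all only:) (simp_all add: algebra_simps)
    then show "z \<in> {z. 0 \<le> s * Re z \<and> 0 \<le> t * Im z \<and> s * Re z + t * Im z = 1}"
      using r(1,2) st by simp
  next
    fix z assume z: "z \<in> {z. 0 \<le> s * Re z \<and> 0 \<le> t * Im z \<and> s * Re z + t * Im z = 1}"
    define r where "r = t * Im z"
    have "1 - r = s * Re z" using z by (auto simp: r_def)
    then have "(1 - r) * s = (s * s) * Re z" "r * t = (t * t) * Im z"
      by (simp_all add: r_def)
    then have "z = (1 - r) *\<^sub>R complex_of_real s + r *\<^sub>R Complex 0 t"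
      using st by (simp add: complex_eq_iff)
    moreover have "0 \<le> r" "r \<le> 1" using z by (auto simp: r_def)
    ultimately show "z \<in> closed_segment (complex_of_real s) (Complex 0 t)"
      by (auto simp: in_segment)
  qed
qed

lemma diamond_sides:
  "closed_segment 1 \<i> = {z. 0 \<le> Re z \<and> 0 \<le> Im z \<and> Re z + Im z = 1}"
  "closed_segment \<i> (-1) = {z. Re z \<le> 0 \<and> 0 \<le> Im z \<and> Im z - Re z = 1}"
  "closed_segment (-1) (-\<i>) = {z. Re z \<le> 0 \<and> Im z \<le> 0 \<and> - Re z - Im z = 1}"
  "closed_segment (-\<i>) 1 = {z. 0 \<le> Re z \<and> Im z \<le> 0 \<and> Re z - Im z = 1}"
proof -
  have i: "Complex 0 1 = \<i>" "Complex 0 (-1) = -\<i>" by (simp_all add: complex_eq_iff)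
  show "closed_segment 1 \<i> = {z. 0 \<le> Re z \<and> 0 \<le> Im z \<and> Re z + Im z = 1}"
    using closed_segment_diamond_side[of 1 1] by (simp add: i)
  show "closed_segment \<i> (-1) = {z. Re z \<le> 0 \<and> 0 \<le> Im z \<and> Im z - Re z = 1}"
    using closed_segment_diamond_side[of "-1" 1] by (simp add: i closed_segment_commute)
  show "closed_segment (-1) (-\<i>) = {z. Re z \<le> 0 \<and> Im z \<le> 0 \<and> - Re z - Im z = 1}"
    using closed_segment_diamond_side[of "-1" "-1"] by (simp add: i)
  show "closed_segment (-\<i>) 1 = {z. 0 \<le> Re z \<and> Im z \<le> 0 \<and> Re z - Im z = 1}"
    using closed_segment_diamond_side[of 1 "-1"] by (simp add: i closed_segment_commute)
qed

lemma vertical_segments: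
  "closed_segment \<i> 0 = {z. Re z = 0 \<and> 0 \<le> Im z \<and> Im z \<le> 1}"
  "closed_segment 0 (-\<i>) = {z. Re z = 0 \<and> -1 \<le> Im z \<and> Im z \<le> 0}"
proof -
  show "closed_segment \<i> 0 = {z. Re z = 0 \<and> 0 \<le> Im z \<and> Im z \<le> 1}"
  proof (intro set_eqI iffI)
    fix z assume "z \<in> {z. Re z = 0 \<and> 0 \<le> Im z \<and> Im z \<le> 1}"
    then show "z \<in> closed_segment \<i> 0"
      unfolding in_segment by (intro exI[of _ "1 - Im z"]) (auto simp: complex_eq_iff)
  qed (auto simp: in_segment)
  show "closed_segment 0 (-\<i>) = {z. Re z = 0 \<and> -1 \<le> Im z \<and> Im z \<le> 0}"
  proof (intro set_eqI iffI)
    fix z assume "z \<in> {z. Re z = 0 \<and> -1 \<le> Im z \<and> Im z \<le> 0}"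
    then show "z \<in> closed_segment 0 (-\<i>)"
      unfolding in_segment by (intro exI[of _ "- Im z"]) (auto simp: complex_eq_iff)
  qed (auto simp: in_segment)
qed

lemma diamond_boundary:
  "diamond - open_diamond =
     closed_segment 1 \<i> \<union> closed_segment \<i> (-1) \<union> closed_segment (-1) (-\<i>) \<union> closed_segment (-\<i>) 1"
  unfolding diamond_sides diamond_def open_diamond_def by auto

text \<open>At height $y$ the diamond is the interval $|x| \<le> 1 - |y|$. This map keeps heights
  and contracts each such interval affinely onto its right half for \<open>\<sigma> = 1\<close> and
  its left half for \<open>\<sigma> = -1\<close>, so it carries the diamond onto a closed half of
  itself.\<close>

definition half_diamond_map :: "real \<Rightarrow> complex \<Rightarrow> complex" where
  "half_diamond_map \<sigma> z = Complex ((Re z + \<sigma> * (1 - \<bar>Im z\<bar>)) / 2) (Im z)"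

text \<open>Images become preimages under the explicit inverse, which reduces the image computations
  below to linear arithmetic with absolute values.\<close>

lemma half_diamond_map_image:
  "half_diamond_map \<sigma> ` A = {z. Complex (2 * Re z - \<sigma> * (1 - \<bar>Im z\<bar>)) (Im z) \<in> A}"
proof (intro set_eqI iffI)
  fix z assume "z \<in> half_diamond_map \<sigma> ` A"
  then obtain w where w: "w \<in> A" "z = half_diamond_map \<sigma> w" by blast
  then have "Complex (2 * Re z - \<sigma> * (1 - \<bar>Im z\<bar>)) (Im z) = w"
    by (simp add: half_diamond_map_def complex_eq_iff)
  with w show "z \<in> {z. Complex (2 * Re z - \<sigma> * (1 - \<bar>Im z\<bar>)) (Im z) \<in> A}" by simp
next
  fix z assume "z \<in> {z. Complex (2 * Re z - \<sigma> * (1 - \<bar>Im z\<bar>)) (Im z) \<in> A}"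
  moreover have "z = half_diamond_map \<sigma> (Complex (2 * Re z - \<sigma> * (1 - \<bar>Im z\<bar>)) (Im z))"
    by (simp add: half_diamond_map_def complex_eq_iff)
  ultimately show "z \<in> half_diamond_map \<sigma> ` A" by blast
qed

lemma half_diamond_map:
  assumes "\<sigma> \<in> {1, -1}"
  shows "continuous_on S (half_diamond_map \<sigma>)" "inj (half_diamond_map \<sigma>)"
    "half_diamond_map \<sigma> ` diamond \<subseteq> diamond"
    "half_diamond_map \<sigma> ` open_diamond = {z \<in> open_diamond. 0 < \<sigma> * Re z}"
proof -
  show "continuous_on S (half_diamond_map \<sigma>)"
    unfolding half_diamond_map_def Complex_eq by (intro continuous_intros) auto
  show "inj (half_diamond_map \<sigma>)"
    by (auto simp: inj_def half_diamond_map_def complex_eq_iff)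
  show "half_diamond_map \<sigma> ` diamond \<subseteq> diamond"
    unfolding half_diamond_map_image diamond_def using assms by (elim insertE emptyE) auto
  show "half_diamond_map \<sigma> ` open_diamond = {z \<in> open_diamond. 0 < \<sigma> * Re z}"
    unfolding half_diamond_map_image open_diamond_def using assms by (elim insertE emptyE) auto
qed

text \<open>The two right sides stay fixed, and the two left sides are pushed onto the two halves of
  the vertical diagonal: these are the edges that a new central vertex contributes.\<close>

lemma right_half_sides:
  "half_diamond_map 1 ` closed_segment 1 \<i> = closed_segment 1 \<i>"
  "half_diamond_map 1 ` closed_segment \<i> (-1) = closed_segment \<i> 0"
  "half_diamond_map 1 ` closed_segment (-1) (-\<i>) = closed_segment 0 (-\<i>)"
  "half_diamond_map 1 ` closed_segment (-\<i>) 1 = closed_segment (-\<i>) 1"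
  unfolding half_diamond_map_image diamond_sides vertical_segments by auto

lemma left_half_sides:
  "half_diamond_map (-1) ` closed_segment 1 \<i> = closed_segment \<i> 0"
  "half_diamond_map (-1) ` closed_segment \<i> (-1) = closed_segment \<i> (-1)"
  "half_diamond_map (-1) ` closed_segment (-1) (-\<i>) = closed_segment (-1) (-\<i>)"
  "half_diamond_map (-1) ` closed_segment (-\<i>) 1 = closed_segment 0 (-\<i>)"
  unfolding half_diamond_map_image diamond_sides vertical_segments by auto

text \<open>Invariance of domain makes the image of the open diamond open, and compactness makes the
  image of the closed one its closure. By injectivity the difference of the two is the image of the
  four sides.\<close>

lemma frontier_diamond_image:
  fixes \<phi> :: "complex \<Rightarrow> complex"
  assumes "continuous_on diamond \<phi>" "inj_on \<phi> diamond"
  shows "open (\<phi> ` open_diamond)" "connected (\<phi> ` open_diamond)"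
    "frontier (\<phi> ` open_diamond) = \<phi> ` closed_segment 1 \<i> \<union> \<phi> ` closed_segment \<i> (-1)
       \<union> \<phi> ` closed_segment (-1) (-\<i>) \<union> \<phi> ` closed_segment (-\<i>) 1"
proof -
  have sub: "continuous_on open_diamond \<phi>" "inj_on \<phi> open_diamond"
    using assms open_diamond_subset continuous_on_subset inj_on_subset by blast+
  show op: "open (\<phi> ` open_diamond)"
    using sub open_open_diamond by (intro invariance_of_domain)
  show "connected (\<phi> ` open_diamond)"
    using sub convex_diamonds by (intro connected_continuous_image convex_connected)
  have "closure (\<phi> ` open_diamond) = \<phi> ` diamond"
  proof
    show "closure (\<phi> ` open_diamond) \<subseteq> \<phi> ` diamond"
      using open_diamond_subset compact_diamond assms(1)
      by (intro closure_minimal image_mono compact_imp_closed compact_continuous_image)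
    show "\<phi> ` diamond \<subseteq> closure (\<phi> ` open_diamond)"
      using image_closure_subset[of open_diamond \<phi> "closure (\<phi> ` open_diamond)"] assms(1)
      by (auto simp: closure_open_diamond closure_subset)
  qed
  then have "frontier (\<phi> ` open_diamond) = \<phi> ` diamond - \<phi> ` open_diamond"
    using op by (simp add: frontier_def interior_open)
  also have "\<dots> = \<phi> ` (diamond - open_diamond)"
    using inj_on_image_set_diff[OF assms(2)] open_diamond_subset by blast
  finally show "frontier (\<phi> ` open_diamond) = \<phi> ` closed_segment 1 \<i> \<union> \<phi> ` closed_segment \<i> (-1)
       \<union> \<phi> ` closed_segment (-1) (-\<i>) \<union> \<phi> ` closed_segment (-\<i>) 1"
    by (simp only: diamond_boundary image_Un)
qed

section \<open>Cells: faces carrying a diamond parametrisation\<close>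

definition quad_drawing ::
  "'a pair_pre_digraph \<Rightarrow> ('a \<Rightarrow> complex) \<Rightarrow> ('a \<times> 'a \<Rightarrow> real \<Rightarrow> complex) \<Rightarrow> bool" where
  "quad_drawing G p \<gamma> \<longleftrightarrow> pair_graph G \<and> Digraph_Component.connected (with_proj G) \<and>
     plane_drawing G p \<gamma> \<and> (\<forall>F\<in>drawing_faces G p \<gamma>. bounded_by_4_cycle G \<gamma> F)"

text \<open>Sides and edges are matched as point sets only, so the speed at which
  \<open>\<gamma>\<close> traverses an edge does not have to agree with
  \<open>\<phi>\<close>.\<close>

definition cell_param ::
  "('a \<Rightarrow> complex) \<Rightarrow> ('a \<times> 'a \<Rightarrow> real \<Rightarrow> complex) \<Rightarrow> 'a \<Rightarrow> 'a \<Rightarrow> 'a \<Rightarrow> 'a \<Rightarrow> complex set \<Rightarrow>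
     (complex \<Rightarrow> complex) \<Rightarrow> bool" where
  "cell_param p \<gamma> a b c d F \<phi> \<longleftrightarrow> continuous_on diamond \<phi> \<and> inj_on \<phi> diamond \<and> \<phi> ` open_diamond = F \<and>
     \<phi> 1 = p a \<and> \<phi> \<i> = p b \<and> \<phi> (-1) = p c \<and> \<phi> (-\<i>) = p d \<and>
     \<phi> ` closed_segment 1 \<i> = path_image (\<gamma> (a, b)) \<and>
     \<phi> ` closed_segment \<i> (-1) = path_image (\<gamma> (b, c)) \<and>
     \<phi> ` closed_segment (-1) (-\<i>) = path_image (\<gamma> (c, d)) \<and>
     \<phi> ` closed_segment (-\<i>) 1 = path_image (\<gamma> (d, a))"

text \<open>Parametrising faces by the diamond makes subdividing a face explicit, so that no
  Schoenflies-type theorem is needed to draw new edges up to a prescribed vertex.\<close>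

definition quad_cell ::
  "'a pair_pre_digraph \<Rightarrow> ('a \<Rightarrow> complex) \<Rightarrow> ('a \<times> 'a \<Rightarrow> real \<Rightarrow> complex) \<Rightarrow>
     'a \<Rightarrow> 'a \<Rightarrow> 'a \<Rightarrow> 'a \<Rightarrow> complex set \<Rightarrow> bool" where
  "quad_cell G p \<gamma> a b c d F \<longleftrightarrow> F \<in> drawing_faces G p \<gamma> \<and>
     {(a, b), (b, c), (c, d), (d, a)} \<subseteq> parcs G \<and> (\<exists>\<phi>. cell_param p \<gamma> a b c d F \<phi>)"

lemma diamond_corners [simp]: "1 \<in> diamond" "-1 \<in> diamond" "\<i> \<in> diamond" "-\<i> \<in> diamond" "0 \<in> diamond"
  by (auto simp: diamond_def)

lemma cell_param_distinct:
  assumes "cell_param p \<gamma> a b c d F \<phi>"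
  shows "distinct [a, b, c, d]"
proof -
  have inj: "inj_on \<phi> diamond" and v: "\<phi> 1 = p a" "\<phi> \<i> = p b" "\<phi> (-1) = p c" "\<phi> (-\<i>) = p d"
    using assms by (auto simp: cell_param_def)
  have "\<phi> 1 \<noteq> \<phi> \<i>" "\<phi> 1 \<noteq> \<phi> (-1)" "\<phi> 1 \<noteq> \<phi> (-\<i>)" "\<phi> \<i> \<noteq> \<phi> (-1)" "\<phi> \<i> \<noteq> \<phi> (-\<i>)" "\<phi> (-1) \<noteq> \<phi> (-\<i>)"
    by (subst inj_on_eq_iff[OF inj]; simp add: complex_eq_iff)+
  then show ?thesis unfolding v by auto
qed

lemma quad_cell_distinct: "quad_cell G p \<gamma> a b c d F \<Longrightarrow> distinct [a, b, c, d]"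
  by (auto simp: quad_cell_def dest: cell_param_distinct)

lemma quad_cell_arcs:
  assumes "quad_cell G p \<gamma> a b c d F"
  shows "(a, b) \<in> parcs G" "(b, c) \<in> parcs G" "(c, d) \<in> parcs G" "(d, a) \<in> parcs G"
  using assms by (auto simp: quad_cell_def)

lemma quad_cell_bounded_by_4_cycle:
  assumes "pair_graph G" "quad_cell G p \<gamma> a b c d F"
  shows "bounded_by_4_cycle G \<gamma> F"
proof -
  interpret pair_graph G by fact
  obtain \<phi> where \<phi>: "cell_param p \<gamma> a b c d F \<phi>" using assms by (auto simp: quad_cell_def)
  then have "frontier F = path_image (\<gamma> (a,b)) \<union> path_image (\<gamma> (b,c)) \<union> path_image (\<gamma> (c,d)) \<union> path_image (\<gamma> (d,a))"
    using frontier_diamond_image(3)[of \<phi>] by (simp add: cell_param_def)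
  moreover have "pair_wf_digraph G" by unfold_locales
  ultimately show ?thesis
    using assms(2) quad_cell_distinct[OF assms(2)]
    by (simp add: bounded_by_4_cycle_iff quad_cell_def) blast
qed

text \<open>Precomposing with multiplication by $i$ moves every corner label one place on. A vertex
  is always inserted along the diagonal between the second and the fourth corner; rotating gives
  access to the other diagonal.\<close>

lemma quad_cell_rotate:
  assumes "quad_cell G p \<gamma> a b c d F"
  shows "quad_cell G p \<gamma> b c d a F"
proof -
  obtain \<phi> where \<phi>: "cell_param p \<gamma> a b c d F \<phi>" using assms by (auto simp: quad_cell_def)
  define r where "r = (\<lambda>z. \<i> * z)"
  have lin: "linear r" unfolding r_def by (simp add: bounded_linear.linear bounded_linear_mult_right)
  have r: "r ` diamond = diamond" "r ` open_diamond = open_diamond"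
  proof -
    have "r ` A = {z. -\<i> * z \<in> A}" for A
      unfolding r_def by (force simp: image_iff complex_eq_iff)
    then show "r ` diamond = diamond" "r ` open_diamond = open_diamond"
      by (auto simp: diamond_def open_diamond_def)
  qed
  have inj: "inj_on r diamond" unfolding r_def by (auto simp: inj_on_def)
  have cont: "continuous_on diamond r" unfolding r_def by (intro continuous_intros)
  have seg: "r ` closed_segment u v = closed_segment (\<i> * u) (\<i> * v)" for u v
    using closed_segment_linear_image[OF lin, of u v] by (simp add: r_def)
  have "cell_param p \<gamma> b c d a F (\<phi> \<circ> r)"
    unfolding cell_param_def
  proof (intro conjI)
    show "continuous_on diamond (\<phi> \<circ> r)"
      using \<phi> r by (intro continuous_on_compose cont) (simp add: cell_param_def)
    show "inj_on (\<phi> \<circ> r) diamond"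
      using \<phi> r by (intro comp_inj_on inj) (simp add: cell_param_def)
  qed (use \<phi> in \<open>simp_all only: image_comp[symmetric] r seg, simp_all add: cell_param_def r_def\<close>)
  then show ?thesis using assms by (auto simp: quad_cell_def)
qed

section \<open>Extending a drawing by an isolated vertex or by an edge\<close>

lemma plane_drawing_add_vertex:
  assumes "plane_drawing G p \<gamma>" "parcs G \<subseteq> pverts G \<times> pverts G" "x \<notin> pverts G" "z \<notin> drawing_image G p \<gamma>"
  shows "plane_drawing \<lparr>pverts = insert x (pverts G), parcs = parcs G\<rparr> (p(x := z)) \<gamma>"
    and "drawing_image \<lparr>pverts = insert x (pverts G), parcs = parcs G\<rparr> (p(x := z)) \<gamma> = insert z (drawing_image G p \<gamma>)"
proof -
  have im: "(p(x := z)) ` insert x (pverts G) = insert z (p ` pverts G)" using assms(3) by auto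
  have nx: "u \<noteq> x" "v \<noteq> x" if "(u, v) \<in> parcs G" for u v using that assms(2,3) by auto
  have z: "z \<notin> p ` pverts G" "z \<notin> path_image (\<gamma> (u, v))" if "(u, v) \<in> parcs G" for u v
    using assms(4) that unfolding drawing_image_def by blast+
  have z': "z \<notin> p ` pverts G" using assms(4) unfolding drawing_image_def by blast
  have inj: "inj_on p (pverts G)" using assms(1) by (simp add: plane_drawing_def)
  have inj': "inj_on (p(x := z)) (insert x (pverts G))"
  proof -
    have "inj_on (p(x := z)) (pverts G)" by (rule inj_on_fun_updI[OF inj z'])
    moreover have "(p(x := z)) ` (pverts G - {x}) = p ` pverts G" using assms(3) by auto
    ultimately show ?thesis using z' by simp
  qed
  have Int: "(p(x := z)) ` ({u, v} \<inter> {x', y'}) = p ` ({u, v} \<inter> {x', y'})" if "(u, v) \<in> parcs G" for u v x' y'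
    using nx[OF that] by auto
  show "plane_drawing \<lparr>pverts = insert x (pverts G), parcs = parcs G\<rparr> (p(x := z)) \<gamma>"
    unfolding plane_drawing_def
  proof (intro conjI allI impI, goal_cases)
    case 1
    then show ?case using inj' by simp
  next
    case (7 u v x' y')
    then have "path_image (\<gamma> (u, v)) \<inter> path_image (\<gamma> (x', y')) = p ` ({u, v} \<inter> {x', y'})"
      using assms(1) unfolding plane_drawing_def by simp
    then show ?case using Int[of u v x' y'] 7 by simp
  next
    case (6 u v)
    then have uv: "(u, v) \<in> parcs G" by simp
    then have "path_image (\<gamma> (u, v)) \<inter> p ` pverts G = {p u, p v}"
      using assms(1) unfolding plane_drawing_def by simp
    moreover have "(p(x := z)) u = p u" "(p(x := z)) v = p v" using nx[OF uv] by simp_all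
    ultimately show ?case using z[OF uv] unfolding pair_pre_digraph.select_convs im by simp
  qed (use assms(1) nx in \<open>auto simp: plane_drawing_def\<close>)
  show "drawing_image \<lparr>pverts = insert x (pverts G), parcs = parcs G\<rparr> (p(x := z)) \<gamma> = insert z (drawing_image G p \<gamma>)"
    unfolding drawing_image_def pair_pre_digraph.select_convs im by simp
qed

text \<open>It suffices to know where the new arc meets the drawing as a whole: its intersection
  with an old edge then consists of those points among \<open>p u\<close> and \<open>p v\<close>
  that lie on that edge, which are images of common end vertices.\<close>

lemma plane_drawing_add_edge:
  assumes pd: "plane_drawing G p \<gamma>" and wf: "parcs G \<subseteq> pverts G \<times> pverts G"
    and uv: "u \<in> pverts G" "v \<in> pverts G" "(u, v) \<notin> parcs G" "(v, u) \<notin> parcs G"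
    and g: "arc g" "pathstart g = p u" "pathfinish g = p v"
    and Int: "path_image g \<inter> drawing_image G p \<gamma> = {p u, p v}"
  defines "G' \<equiv> \<lparr>pverts = pverts G, parcs = insert (u, v) (insert (v, u) (parcs G))\<rparr>"
    and "\<gamma>' \<equiv> \<gamma>((u, v) := g, (v, u) := reversepath g)"
  shows "plane_drawing G' p \<gamma>'"
    and "drawing_image G' p \<gamma>' = drawing_image G p \<gamma> \<union> path_image g"
proof -
  have ne: "u \<noteq> v" using g arc_distinct_ends by metis
  have inj: "inj_on p (pverts G)" using pd by (simp add: plane_drawing_def)
  have old: "\<gamma>' e = \<gamma> e" if "e \<in> parcs G" for e
  proof -
    have "e \<noteq> (u, v)" "e \<noteq> (v, u)" using that uv by blast+
    then show ?thesis by (simp add: \<gamma>'_def)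
  qed
  have new: "\<gamma>' (u, v) = g" "\<gamma>' (v, u) = reversepath g" using ne by (simp_all add: \<gamma>'_def)
  have gV: "path_image g \<inter> p ` pverts G = {p u, p v}"
    using Int uv unfolding drawing_image_def by blast
  have gA: "path_image g \<inter> path_image (\<gamma> (x, y)) = p ` ({u, v} \<inter> {x, y})" if xy: "(x, y) \<in> parcs G" for x y
  proof -
    have xyV: "path_image (\<gamma> (x, y)) \<inter> p ` pverts G = {p x, p y}" "x \<in> pverts G" "y \<in> pverts G"
      using pd xy wf unfolding plane_drawing_def by blast+
    have "path_image g \<inter> path_image (\<gamma> (x, y)) = {p u, p v} \<inter> path_image (\<gamma> (x, y))"
      using Int xy unfolding drawing_image_def by blast
    also have "\<dots> = {p u, p v} \<inter> {p x, p y}" using xyV uv by blast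
    also have "\<dots> = p ` {u, v} \<inter> p ` {x, y}" by simp
    also have "\<dots> = p ` ({u, v} \<inter> {x, y})"
      using inj uv xyV by (intro inj_on_image_Int[symmetric, of p "pverts G"]) auto
    finally show ?thesis .
  qed
  show "plane_drawing G' p \<gamma>'"
    unfolding plane_drawing_def
  proof (intro conjI allI impI)
    show "inj_on p (pverts G')" using inj by (simp add: G'_def)
  next
    fix x y assume "(x, y) \<in> parcs G'"
    then consider "x = u" "y = v" | "x = v" "y = u" | "(x, y) \<in> parcs G" unfolding G'_def by auto
    then have "Path_Connected.arc (\<gamma>' (x, y)) \<and> pathstart (\<gamma>' (x, y)) = p x \<and> pathfinish (\<gamma>' (x, y)) = p y \<and>
      \<gamma>' (y, x) = reversepath (\<gamma>' (x, y)) \<and> path_image (\<gamma>' (x, y)) \<inter> p ` pverts G' = {p x, p y}"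
    proof cases
      case 1
      then show ?thesis using g gV new by (simp add: G'_def)
    next
      case 2
      then show ?thesis using g gV new by (auto simp add: G'_def arc_reversepath)
    next
      case 3
      have "(y, x) \<noteq> (u, v)" "(y, x) \<noteq> (v, u)" using 3 uv by auto
      then have "\<gamma>' (y, x) = \<gamma> (y, x)" unfolding \<gamma>'_def by (simp only: fun_upd_other not_False_eq_True)
      moreover have "Path_Connected.arc (\<gamma> (x, y)) \<and> pathstart (\<gamma> (x, y)) = p x \<and> pathfinish (\<gamma> (x, y)) = p y \<and>
        \<gamma> (y, x) = reversepath (\<gamma> (x, y)) \<and> path_image (\<gamma> (x, y)) \<inter> p ` pverts G = {p x, p y}"
        using pd 3 unfolding plane_drawing_def by blast
      ultimately show ?thesis using old[OF 3] by (simp add: G'_def)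
    qed
    then show "Path_Connected.arc (\<gamma>' (x, y))" "pathstart (\<gamma>' (x, y)) = p x" "pathfinish (\<gamma>' (x, y)) = p y"
      "\<gamma>' (y, x) = reversepath (\<gamma>' (x, y))" "path_image (\<gamma>' (x, y)) \<inter> p ` pverts G' = {p x, p y}"
      by blast+
  next
    fix x y x' y' assume h: "(x, y) \<in> parcs G'" "(x', y') \<in> parcs G'" "{x, y} \<noteq> {x', y'}"
    have cs: "{a, b} = {u, v} \<and> path_image (\<gamma>' (a, b)) = path_image g \<or> (a, b) \<in> parcs G" if "(a, b) \<in> parcs G'" for a b
      using that new by (auto simp: G'_def)
    show "path_image (\<gamma>' (x, y)) \<inter> path_image (\<gamma>' (x', y')) = p ` ({x, y} \<inter> {x', y'})"
    proof (cases "(x, y) \<in> parcs G")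
      case xy: True
      show ?thesis
      proof (cases "(x', y') \<in> parcs G")
        case True
        then have "path_image (\<gamma> (x, y)) \<inter> path_image (\<gamma> (x', y')) = p ` ({x, y} \<inter> {x', y'})"
          using pd xy h(3) unfolding plane_drawing_def by blast
        then show ?thesis using old[OF xy] old[OF True] by simp
      next
        case False
        then have "{x', y'} = {u, v}" "path_image (\<gamma>' (x', y')) = path_image g" using cs[OF h(2)] by auto
        then show ?thesis using gA[OF xy] old[OF xy] by (simp add: Int_commute)
      qed
    next
      case False
      then have xy: "{x, y} = {u, v}" "path_image (\<gamma>' (x, y)) = path_image g" using cs[OF h(1)] by auto
      then have "(x', y') \<in> parcs G" using cs[OF h(2)] h(3) by auto
      then show ?thesis using gA[of x' y'] old[of "(x', y')"] xy by simp
    qed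
  qed
  have "(\<Union>e\<in>parcs G'. path_image (\<gamma>' e)) = (\<Union>e\<in>parcs G. path_image (\<gamma> e)) \<union> path_image g"
    using new old by (simp add: G'_def Un_commute)
  then show "drawing_image G' p \<gamma>' = drawing_image G p \<gamma> \<union> path_image g"
    unfolding drawing_image_def by (simp add: G'_def Un_assoc)
qed

section \<open>Subdividing a cell by a vertex joined to two opposite corners\<close>

definition add_vertex :: "'a pair_pre_digraph \<Rightarrow> 'a \<Rightarrow> 'a \<Rightarrow> 'a \<Rightarrow> 'a pair_pre_digraph" where
  "add_vertex G b d x = \<lparr>pverts = insert x (pverts G),
     parcs = insert (d, x) (insert (x, d) (insert (b, x) (insert (x, b) (parcs G))))\<rparr>"

lemma pair_graph_add_vertex:
  assumes "pair_graph G" "b \<in> pverts G" "d \<in> pverts G" "x \<notin> pverts G"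
  shows "pair_graph (add_vertex G b d x)"
proof -
  interpret pair_graph G by fact
  have "sym (parcs (add_vertex G b d x))"
    using arcs_symmetric by (auto simp: add_vertex_def sym_def)
  then show ?thesis
    using assms(2-4) pair_finite_verts pair_finite_arcs in_arcsD1 in_arcsD2 no_loops'
    by unfold_locales (auto simp: add_vertex_def symmetric_def)
qed

lemma connected_add_vertex:
  assumes "pair_graph G" "b \<in> pverts G" "d \<in> pverts G" "x \<notin> pverts G"
    "Digraph_Component.connected (with_proj G)"
  shows "Digraph_Component.connected (with_proj (add_vertex G b d x))"
proof -
  let ?A = "parcs (add_vertex G b d x)"
  have "pverts G \<noteq> {}" and c: "\<And>u v. u \<in> pverts G \<Longrightarrow> v \<in> pverts G \<Longrightarrow> (u, v) \<in> (parcs G)\<^sup>*"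
    using assms(5) unfolding connected_iff_rtrancl[OF assms(1)] by auto
  moreover have "(parcs G)\<^sup>* \<subseteq> ?A\<^sup>*" by (intro rtrancl_mono) (auto simp: add_vertex_def)
  moreover have "(b, x) \<in> ?A\<^sup>*" "(x, b) \<in> ?A\<^sup>*" by (auto simp: add_vertex_def)
  ultimately have to_b: "(u, b) \<in> ?A\<^sup>*" "(b, u) \<in> ?A\<^sup>*" if "u \<in> insert x (pverts G)" for u
    using that assms(2) by auto
  have "(u, v) \<in> ?A\<^sup>*" if "u \<in> insert x (pverts G)" "v \<in> insert x (pverts G)" for u v
    using to_b(1)[OF that(1)] to_b(2)[OF that(2)] by (rule rtrancl_trans)
  then show ?thesis
    unfolding connected_iff_rtrancl[OF pair_graph_add_vertex[OF assms(1-4)]]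
    by (auto simp: add_vertex_def)
qed

lemma out_degree_add_vertex:
  assumes "pair_graph G" "b \<in> pverts G" "d \<in> pverts G" "x \<notin> pverts G" "b \<noteq> d"
  shows "out_degree (with_proj (add_vertex G b d x)) v =
    (if v = x then 2 else if v = b \<or> v = d then out_degree (with_proj G) v + 1 else out_degree (with_proj G) v)"
proof -
  interpret pair_graph G by fact
  have fin: "finite {e \<in> parcs G. fst e = v}" using pair_finite_arcs by simp
  have nx: "(u, w) \<in> parcs G \<Longrightarrow> u \<noteq> x \<and> w \<noteq> x" for u w using assms(4) in_arcsD1 in_arcsD2 by blast
  have "{e \<in> parcs (add_vertex G b d x). fst e = v} =
    (if v = x then {(x, b), (x, d)} else if v = b \<or> v = d then insert (v, x) {e \<in> parcs G. fst e = v} else {e \<in> parcs G. fst e = v})"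
    (is "?L = ?R")
  proof (rule set_eqI)
    fix e show "e \<in> ?L \<longleftrightarrow> e \<in> ?R"
      using nx[of "fst e" "snd e"] assms(2-5) by (cases e) (auto simp: add_vertex_def)
  qed
  moreover have "(v, x) \<notin> {e \<in> parcs G. fst e = v}" using nx by blast
  ultimately show ?thesis unfolding out_degree_with_proj using fin assms(5) by auto
qed

lemma arc_compose_linepath:
  assumes "continuous_on D \<phi>" "inj_on \<phi> D" "closed_segment u v \<subseteq> D" "u \<noteq> v"
  shows "arc (\<phi> \<circ> linepath u v)" "path_image (\<phi> \<circ> linepath u v) = \<phi> ` closed_segment u v"
proof -
  have l: "arc (linepath u v)" "path_image (linepath u v) = closed_segment u v"
    using assms(4) by (simp_all add: arc_linepath)
  have "path (\<phi> \<circ> linepath u v)"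
    using assms(1,3) l(2) by (intro path_continuous_image) (auto intro: continuous_on_subset)
  moreover have "inj_on (\<phi> \<circ> linepath u v) {0..1}"
  proof (rule comp_inj_on)
    show "inj_on (linepath u v) {0..1}" using l(1) by (simp add: arc_def)
    show "inj_on \<phi> (linepath u v ` {0..1})"
      using assms(2,3) l(2) unfolding path_image_def by (metis inj_on_subset)
  qed
  ultimately show "arc (\<phi> \<circ> linepath u v)" by (simp add: arc_def)
  show "path_image (\<phi> \<circ> linepath u v) = \<phi> ` closed_segment u v"
    by (simp add: path_image_compose)
qed

lemma half_diamond_map_corners:
  "half_diamond_map 1 1 = 1" "half_diamond_map 1 \<i> = \<i>" "half_diamond_map 1 (-1) = 0" "half_diamond_map 1 (-\<i>) = -\<i>"
  "half_diamond_map (-1) 1 = 0" "half_diamond_map (-1) \<i> = \<i>" "half_diamond_map (-1) (-1) = -1"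
  "half_diamond_map (-1) (-\<i>) = -\<i>"
  by (simp_all add: half_diamond_map_def complex_eq_iff)

text \<open>The vertex goes to \<open>\<phi> 0\<close> and its edges are the images of the two
  halves of the vertical diagonal. The new faces are the images of the open half diamonds, and
  \<open>half_diamond_map\<close> turns each half back into a full diamond, so both are again cells.
  The last clause lets other cells be worked on later.\<close>

lemma add_vertex_in_cell:
  assumes Q: "quad_drawing G p \<gamma>" and cell: "quad_cell G p \<gamma> a b c d F" and x: "x \<notin> pverts G"
  defines "G' \<equiv> add_vertex G b d x"
  shows "\<exists>p' \<gamma>' F1 F2. quad_drawing G' p' \<gamma>' \<and> quad_cell G' p' \<gamma>' a b x d F1 \<and>
    quad_cell G' p' \<gamma>' x b c d F2 \<and> F1 \<noteq> F2 \<and> F1 \<subseteq> F \<and> F2 \<subseteq> F \<and>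
    (\<forall>a' b' c' d' F'. quad_cell G p \<gamma> a' b' c' d' F' \<longrightarrow> F' \<noteq> F \<longrightarrow> quad_cell G' p' \<gamma>' a' b' c' d' F')"
proof -
  have G: "pair_graph G" and conn: "Digraph_Component.connected (with_proj G)"
    and pd: "plane_drawing G p \<gamma>" and bd: "\<And>F. F \<in> drawing_faces G p \<gamma> \<Longrightarrow> bounded_by_4_cycle G \<gamma> F"
    using Q by (auto simp: quad_drawing_def)
  interpret pair_graph G by fact
  obtain \<phi> where \<phi>: "cell_param p \<gamma> a b c d F \<phi>" using cell by (auto simp: quad_cell_def)
  then have cont: "continuous_on diamond \<phi>" and inj: "inj_on \<phi> diamond" and F: "\<phi> ` open_diamond = F"
    and corners: "\<phi> 1 = p a" "\<phi> \<i> = p b" "\<phi> (-1) = p c" "\<phi> (-\<i>) = p d"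
    by (simp_all add: cell_param_def)
  note arcs = quad_cell_arcs[OF cell]
  have V: "a \<in> pverts G" "b \<in> pverts G" "c \<in> pverts G" "d \<in> pverts G"
    using arcs in_arcsD1 in_arcsD2 by blast+
  have bd_ne: "b \<noteq> d" using quad_cell_distinct[OF cell] by simp
  have wf: "parcs G \<subseteq> pverts G \<times> pverts G" using in_arcsD1 in_arcsD2 by auto
  have nx: "(x, v) \<notin> parcs G" "(v, x) \<notin> parcs G" for v using x in_arcsD1 in_arcsD2 by blast+
  define X where "X = drawing_image G p \<gamma>"
  have face: "F \<in> components (- X)" using cell by (simp add: quad_cell_def drawing_faces_def X_def)
  have FX: "F \<inter> X = {}" using in_components_subset[OF face] by blast
  have pX: "p b \<in> X" "p d \<in> X" using V by (auto simp: X_def drawing_image_def)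
  define T1 T2 where "T1 = closed_segment \<i> (0::complex)" and "T2 = closed_segment (-\<i>) (0::complex)"
  have T2': "T2 = closed_segment 0 (-\<i>)" unfolding T2_def by (rule closed_segment_commute)
  have T: "T1 \<subseteq> insert \<i> open_diamond" "T2 \<subseteq> insert (-\<i>) open_diamond" "T1 \<inter> T2 = {0}"
    "T1 \<union> T2 = {\<i>, -\<i>} \<union> {z \<in> open_diamond. Re z = 0}" "T1 \<subseteq> diamond" "T2 \<subseteq> diamond"
    unfolding T1_def T2' vertical_segments by (auto simp: open_diamond_def diamond_def complex_eq_iff)
  have ends: "0 \<in> T1" "\<i> \<in> T1" "0 \<in> T2" "-\<i> \<in> T2" by (simp_all add: T1_def T2_def)
  \<comment> \<open>Both curves run from the old corner to the centre, matching the arcs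
    \<open>(b, x)\<close> and \<open>(d, x)\<close>.\<close>
  define g1 g2 where "g1 = \<phi> \<circ> linepath \<i> 0" and "g2 = \<phi> \<circ> linepath (-\<i>) 0"
  have g1: "Path_Connected.arc g1" "path_image g1 = \<phi> ` T1" "pathstart g1 = p b" "pathfinish g1 = \<phi> 0"
    using arc_compose_linepath[OF cont inj, of \<i> 0] T(5) corners
    by (simp_all add: g1_def T1_def pathstart_compose pathfinish_compose)
  have g2: "Path_Connected.arc g2" "path_image g2 = \<phi> ` T2" "pathstart g2 = p d" "pathfinish g2 = \<phi> 0"
    using arc_compose_linepath[OF cont inj, of "-\<i>" 0] T(6) corners
    by (simp_all add: g2_def T2_def pathstart_compose pathfinish_compose)
  have "0 \<in> open_diamond" by (simp add: open_diamond_def)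
  then have "\<phi> 0 \<in> F" using F by blast
  then have z: "\<phi> 0 \<notin> X" using FX by blast
  have T1F: "\<phi> ` T1 \<subseteq> insert (p b) F" and T2F: "\<phi> ` T2 \<subseteq> insert (p d) F"
    using T(1,2) F corners by blast+
  have T12: "\<phi> ` T2 \<inter> \<phi> ` T1 = {\<phi> 0}"
    using inj_on_image_Int[OF inj T(6,5)] T(3) by (simp add: Int_commute)
  have T1X: "\<phi> ` T1 \<inter> insert (\<phi> 0) X = {p b, \<phi> 0}"
  proof -
    have "p b \<in> \<phi> ` T1" "\<phi> 0 \<in> \<phi> ` T1" using ends corners by (metis imageI)+
    then show ?thesis using T1F FX pX by blast
  qed
  have T2X: "\<phi> ` T2 \<inter> (insert (\<phi> 0) X \<union> \<phi> ` T1) = {p d, \<phi> 0}"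
  proof -
    have "p d \<in> \<phi> ` T2" "\<phi> 0 \<in> \<phi> ` T2" using ends corners by (metis imageI)+
    moreover have "\<phi> ` T2 \<inter> X \<subseteq> {p d}" using T2F FX by blast
    ultimately show ?thesis using T12 pX by blast
  qed
  define G1 where "G1 = \<lparr>pverts = insert x (pverts G), parcs = parcs G\<rparr>"
  define G2 where "G2 = \<lparr>pverts = pverts G1, parcs = insert (b, x) (insert (x, b) (parcs G1))\<rparr>"
  have G': "G' = \<lparr>pverts = pverts G2, parcs = insert (d, x) (insert (x, d) (parcs G2))\<rparr>"
    by (simp add: G'_def add_vertex_def G2_def G1_def)
  define p' where "p' = p(x := \<phi> 0)"
  define \<gamma>2 where "\<gamma>2 = \<gamma>((b, x) := g1, (x, b) := reversepath g1)"
  define \<gamma>' where "\<gamma>' = \<gamma>2((d, x) := g2, (x, d) := reversepath g2)"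
  have p': "p' x = \<phi> 0" "\<And>v. v \<in> pverts G \<Longrightarrow> p' v = p v" using x by (auto simp: p'_def)
  have d1: "plane_drawing G1 p' \<gamma>" "drawing_image G1 p' \<gamma> = insert (\<phi> 0) X"
    unfolding G1_def p'_def X_def using plane_drawing_add_vertex[OF pd wf x] z X_def by auto
  have d2: "plane_drawing G2 p' \<gamma>2" "drawing_image G2 p' \<gamma>2 = insert (\<phi> 0) X \<union> \<phi> ` T1"
  proof -
    have h: "parcs G1 \<subseteq> pverts G1 \<times> pverts G1" "b \<in> pverts G1" "x \<in> pverts G1" "(b, x) \<notin> parcs G1" "(x, b) \<notin> parcs G1"
      "pathstart g1 = p' b" "pathfinish g1 = p' x" "path_image g1 \<inter> drawing_image G1 p' \<gamma> = {p' b, p' x}"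
      using wf V nx g1 p' T1X d1(2) by (auto simp: G1_def)
    show "plane_drawing G2 p' \<gamma>2" "drawing_image G2 p' \<gamma>2 = insert (\<phi> 0) X \<union> \<phi> ` T1"
      unfolding G2_def \<gamma>2_def
      using plane_drawing_add_edge[OF d1(1) h(1-5) g1(1) h(6-8)] d1(2) g1(2) by simp_all
  qed
  have d3: "plane_drawing G' p' \<gamma>'" "drawing_image G' p' \<gamma>' = insert (\<phi> 0) X \<union> \<phi> ` T1 \<union> \<phi> ` T2"
  proof -
    have h: "parcs G2 \<subseteq> pverts G2 \<times> pverts G2" "d \<in> pverts G2" "x \<in> pverts G2" "(d, x) \<notin> parcs G2" "(x, d) \<notin> parcs G2"
      "pathstart g2 = p' d" "pathfinish g2 = p' x" "path_image g2 \<inter> drawing_image G2 p' \<gamma>2 = {p' d, p' x}"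
      using wf V nx g2 p' T2X d2(2) x bd_ne by (auto simp: G1_def G2_def)
    show "plane_drawing G' p' \<gamma>'" "drawing_image G' p' \<gamma>' = insert (\<phi> 0) X \<union> \<phi> ` T1 \<union> \<phi> ` T2"
      unfolding G' \<gamma>'_def
      using plane_drawing_add_edge[OF d2(1) h(1-5) g2(1) h(6-8)] d2(2) g2(2) by simp_all
  qed
  have old: "\<gamma>' e = \<gamma> e" if "e \<in> parcs G" for e
  proof -
    have "e \<noteq> (b, x)" "e \<noteq> (x, b)" "e \<noteq> (d, x)" "e \<noteq> (x, d)" using that nx by blast+
    then show ?thesis by (simp add: \<gamma>'_def \<gamma>2_def)
  qed
  have new: "\<gamma>' (b, x) = g1" "\<gamma>' (x, b) = reversepath g1" "\<gamma>' (d, x) = g2" "\<gamma>' (x, d) = reversepath g2"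
  proof -
    have "x \<noteq> b" "x \<noteq> d" "b \<noteq> x" "d \<noteq> x" using x V by blast+
    then show "\<gamma>' (b, x) = g1" "\<gamma>' (x, b) = reversepath g1" "\<gamma>' (d, x) = g2" "\<gamma>' (x, d) = reversepath g2"
      using bd_ne by (simp_all add: \<gamma>'_def \<gamma>2_def)
  qed
  have sub: "parcs G \<subseteq> parcs G'" by (auto simp: G'_def add_vertex_def)
  have pg': "pair_graph G'" unfolding G'_def by (rule pair_graph_add_vertex[OF G V(2,4) x])
  have conn': "Digraph_Component.connected (with_proj G')"
    unfolding G'_def by (rule connected_add_vertex[OF G V(2,4) x conn])

  define H where "H \<sigma> = \<phi> \<circ> half_diamond_map \<sigma>" for \<sigma>
  define Fh where "Fh \<sigma> = H \<sigma> ` open_diamond" for \<sigma>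
  have Fh: "Fh \<sigma> = \<phi> ` {z \<in> open_diamond. 0 < \<sigma> * Re z}" if "\<sigma> \<in> {1, -1}" for \<sigma>
    unfolding Fh_def H_def image_comp[symmetric] half_diamond_map(4)[OF that] ..
  have H: "continuous_on diamond (H \<sigma>)" "inj_on (H \<sigma>) diamond" if "\<sigma> \<in> {1, -1}" for \<sigma>
  proof -
    show "continuous_on diamond (H \<sigma>)" unfolding H_def
      using half_diamond_map(1,3)[OF that] cont by (intro continuous_on_compose) (auto intro: continuous_on_subset)
    show "inj_on (H \<sigma>) diamond" unfolding H_def
      using half_diamond_map(2,3)[OF that] inj by (intro comp_inj_on) (auto intro: inj_on_subset)
  qed
  have s: "(1::real) \<in> {1, -1}" "(-1::real) \<in> {1, -1}" by simp_all
  have Fh_props: "open (Fh \<sigma>)" "connected (Fh \<sigma>)" "Fh \<sigma> \<noteq> {}" "Fh \<sigma> \<subseteq> F" if "\<sigma> \<in> {1, -1}" for \<sigma>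
  proof -
    show "open (Fh \<sigma>)" "connected (Fh \<sigma>)"
      unfolding Fh_def using frontier_diamond_image(1,2)[OF H[OF that]] by simp_all
    show "Fh \<sigma> \<noteq> {}" unfolding Fh_def using \<open>0 \<in> open_diamond\<close> by blast
    show "Fh \<sigma> \<subseteq> F" unfolding Fh[OF that] using F by blast
  qed
  have disj: "Fh 1 \<inter> Fh (-1) = {}"
  proof -
    have "Fh 1 \<inter> Fh (-1) = \<phi> ` ({z \<in> open_diamond. 0 < 1 * Re z} \<inter> {z \<in> open_diamond. 0 < -1 * Re z})"
      unfolding Fh[OF s(1)] Fh[OF s(2)]
      by (rule inj_on_image_Int[OF inj, symmetric]) (use open_diamond_subset in auto)
    also have "{z \<in> open_diamond. 0 < 1 * Re z} \<inter> {z \<in> open_diamond. 0 < -1 * Re z} = {}" by auto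
    finally show ?thesis by simp
  qed
  \<comment> \<open>The ends of the diagonal are the old points \<open>p b\<close> and
    \<open>p d\<close>, so the drawing grows exactly by the part of the diagonal inside
    \<open>F\<close>.\<close>
  have img: "drawing_image G' p' \<gamma>' = X \<union> \<phi> ` {z \<in> open_diamond. Re z = 0}"
  proof -
    have T12u: "\<phi> ` T1 \<union> \<phi> ` T2 = {p b, p d} \<union> \<phi> ` {z \<in> open_diamond. Re z = 0}"
      using T(4) corners by (simp add: image_Un[symmetric] del: image_Un)
    have 0: "\<phi> 0 \<in> \<phi> ` {z \<in> open_diamond. Re z = 0}" using \<open>0 \<in> open_diamond\<close> by (intro imageI) simp
    have "drawing_image G' p' \<gamma>' = insert (\<phi> 0) X \<union> (\<phi> ` T1 \<union> \<phi> ` T2)"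
      unfolding d3(2) by (rule Un_assoc)
    also have "\<dots> = X \<union> \<phi> ` {z \<in> open_diamond. Re z = 0}"
      unfolding T12u using insert_absorb[OF 0] insert_absorb[OF pX(1)] insert_absorb[OF pX(2)]
      by (metis (no_types, lifting) Un_empty_left Un_insert_left Un_insert_right)
    finally show ?thesis .
  qed
  have split: "Fh 1 \<union> Fh (-1) = F - \<phi> ` {z \<in> open_diamond. Re z = 0}"
  proof -
    have "F - \<phi> ` {z \<in> open_diamond. Re z = 0} = \<phi> ` (open_diamond - {z \<in> open_diamond. Re z = 0})"
      unfolding F[symmetric] by (rule inj_on_image_set_diff[OF inj, symmetric]) (use open_diamond_subset in auto)
    also have "open_diamond - {z \<in> open_diamond. Re z = 0} = {z \<in> open_diamond. 0 < 1 * Re z} \<union> {z \<in> open_diamond. 0 < -1 * Re z}"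
      by auto
    finally show ?thesis unfolding Fh[OF s(1)] Fh[OF s(2)] by (simp add: image_Un)
  qed
  have comp_disj: "A \<inter> B = {}" if "A \<in> components (- X)" "B \<in> components (- X)" "A \<noteq> B" for A B
    using components_eq[OF that(1,2)] that(3) by blast
  \<comment> \<open>Disjoint, nonempty, open and connected sets covering the complement are its
    components; this identifies the new faces exactly.\<close>
  have faces: "drawing_faces G' p' \<gamma>' = (components (- X) - {F}) \<union> {Fh 1, Fh (-1)}"
    unfolding drawing_faces_def
  proof (rule components_open_unique)
    have "Fh 1 \<inter> A = {} \<and> Fh (-1) \<inter> A = {}" if "A \<in> components (- X) - {F}" for A
      using that comp_disj[OF face, of A] Fh_props(4)[OF s(1)] Fh_props(4)[OF s(2)] by blast
    then show "pairwise disjnt ((components (- X) - {F}) \<union> {Fh 1, Fh (-1)})"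
      using disj comp_disj unfolding pairwise_def disjnt_def by (auto simp: Int_commute)
    have "\<Union> (components (- X) - {F}) = - X - F"
    proof
      show "\<Union> (components (- X) - {F}) \<subseteq> - X - F"
        using comp_disj[OF _ face] in_components_subset by blast
      show "- X - F \<subseteq> \<Union> (components (- X) - {F})"
        using Union_components[of "- X"] by blast
    qed
    then have "\<Union> ((components (- X) - {F}) \<union> {Fh 1, Fh (-1)}) = (- X - F) \<union> (Fh 1 \<union> Fh (-1))"
      by (simp add: Un_ac)
    also have "\<dots> = - drawing_image G' p' \<gamma>'"
    proof -
      have "\<phi> ` {z \<in> open_diamond. Re z = 0} \<subseteq> F" using F by blast
      then show ?thesis unfolding split img using FX by blast
    qed
    finally show "\<Union> ((components (- X) - {F}) \<union> {Fh 1, Fh (-1)}) = - drawing_image G' p' \<gamma>'" .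
    have "closed X" unfolding X_def
      using plane_graph.compact_subgraph_image[of G p \<gamma> "pverts G" "parcs G"] pd G
      unfolding drawing_image_def by (simp add: plane_graph_def plane_graph_axioms_def compact_imp_closed)
    then have "open (- X)" by (rule open_Compl)
    then show "open A \<and> connected A \<and> A \<noteq> {}" if "A \<in> (components (- X) - {F}) \<union> {Fh 1, Fh (-1)}" for A
      using that Fh_props(1-3)[OF s(1)] Fh_props(1-3)[OF s(2)] open_components in_components_connected in_components_nonempty
      by blast
  qed
  have sides: "\<phi> ` closed_segment 1 \<i> = path_image (\<gamma> (a, b))" "\<phi> ` closed_segment \<i> (-1) = path_image (\<gamma> (b, c))"
    "\<phi> ` closed_segment (-1) (-\<i>) = path_image (\<gamma> (c, d))" "\<phi> ` closed_segment (-\<i>) 1 = path_image (\<gamma> (d, a))"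
    using \<phi> by (simp_all add: cell_param_def)
  have H_image: "H \<sigma> ` S = \<phi> ` half_diamond_map \<sigma> ` S" and H_apply: "H \<sigma> w = \<phi> (half_diamond_map \<sigma> w)" for \<sigma> S w
    by (auto simp: H_def)
  have H_sides:
    "H 1 ` closed_segment 1 \<i> = path_image (\<gamma> (a, b))" "H 1 ` closed_segment \<i> (-1) = path_image g1"
    "H 1 ` closed_segment (-1) (-\<i>) = path_image g2" "H 1 ` closed_segment (-\<i>) 1 = path_image (\<gamma> (d, a))"
    "H (-1) ` closed_segment 1 \<i> = path_image g1" "H (-1) ` closed_segment \<i> (-1) = path_image (\<gamma> (b, c))"
    "H (-1) ` closed_segment (-1) (-\<i>) = path_image (\<gamma> (c, d))" "H (-1) ` closed_segment (-\<i>) 1 = path_image g2"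
    unfolding H_image right_half_sides left_half_sides sides g1(2) g2(2) T1_def T2' by (rule refl)+
  have H_corners: "H 1 1 = \<phi> 1" "H 1 \<i> = \<phi> \<i>" "H 1 (-1) = \<phi> 0" "H 1 (-\<i>) = \<phi> (-\<i>)"
    "H (-1) 1 = \<phi> 0" "H (-1) \<i> = \<phi> \<i>" "H (-1) (-1) = \<phi> (-1)" "H (-1) (-\<i>) = \<phi> (-\<i>)"
    by (simp_all add: H_apply half_diamond_map_corners)
  have c1: "cell_param p' \<gamma>' a b x d (Fh 1) (H 1)"
    unfolding cell_param_def using H[OF s(1)] corners p' V old arcs new
    by (simp add: H_sides H_corners Fh_def)
  have c2: "cell_param p' \<gamma>' x b c d (Fh (-1)) (H (-1))"
    unfolding cell_param_def using H[OF s(2)] corners p' V old arcs new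
    by (simp add: H_sides H_corners Fh_def)
  have q1: "quad_cell G' p' \<gamma>' a b x d (Fh 1)"
    unfolding quad_cell_def faces using c1 arcs by (auto simp: G'_def add_vertex_def)
  have q2: "quad_cell G' p' \<gamma>' x b c d (Fh (-1))"
    unfolding quad_cell_def faces using c2 arcs by (auto simp: G'_def add_vertex_def)
  have q3: "quad_cell G' p' \<gamma>' a' b' c' d' F'" if q: "quad_cell G p \<gamma> a' b' c' d' F'" "F' \<noteq> F" for a' b' c' d' F'
  proof -
    obtain \<psi> where \<psi>: "cell_param p \<gamma> a' b' c' d' F' \<psi>" using q by (auto simp: quad_cell_def)
    note arcs' = quad_cell_arcs[OF q(1)]
    have V': "a' \<in> pverts G" "b' \<in> pverts G" "c' \<in> pverts G" "d' \<in> pverts G"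
      using arcs' in_arcsD1 in_arcsD2 by blast+
    \<comment> \<open>The old parametrisation serves unchanged, as positions of old vertices and
      curves of old arcs are untouched.\<close>
    have "cell_param p' \<gamma>' a' b' c' d' F' \<psi>"
      using \<psi> unfolding cell_param_def old[OF arcs'(1)] old[OF arcs'(2)] old[OF arcs'(3)] old[OF arcs'(4)]
        p'(2)[OF V'(1)] p'(2)[OF V'(2)] p'(2)[OF V'(3)] p'(2)[OF V'(4)] .
    moreover have "F' \<in> drawing_faces G' p' \<gamma>'"
      unfolding faces using q by (simp add: quad_cell_def drawing_faces_def X_def)
    ultimately show ?thesis using arcs' sub unfolding quad_cell_def by blast
  qed
  have "bounded_by_4_cycle G' \<gamma>' F'" if F': "F' \<in> drawing_faces G' p' \<gamma>'" for F'
  proof (cases "F' \<in> {Fh 1, Fh (-1)}")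
    case True
    then show ?thesis using quad_cell_bounded_by_4_cycle[OF pg' q1] quad_cell_bounded_by_4_cycle[OF pg' q2] by blast
  next
    \<comment> \<open>This also covers faces that are no cells, such as the outer one: the frontier
      and the bounding 4-cycle remain the same.\<close>
    case False
    then have "F' \<in> drawing_faces G p \<gamma>" using F' unfolding faces by (simp add: drawing_faces_def X_def)
    moreover have wfG: "pair_wf_digraph G" "pair_wf_digraph G'"
      using G pg' by (simp_all add: pair_graph_def pair_digraph_def pair_fin_digraph_def)
    ultimately obtain a' b' c' d' where c4: "distinct [a',b',c',d']" "{(a',b'),(b',c'),(c',d'),(d',a')} \<subseteq> parcs G"
      "frontier F' = path_image (\<gamma> (a',b')) \<union> path_image (\<gamma> (b',c')) \<union> path_image (\<gamma> (c',d')) \<union> path_image (\<gamma> (d',a'))"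
      using bd[of F'] bounded_by_4_cycle_iff[OF wfG(1)] by blast
    have "frontier F' = path_image (\<gamma>' (a',b')) \<union> path_image (\<gamma>' (b',c')) \<union> path_image (\<gamma>' (c',d')) \<union> path_image (\<gamma>' (d',a'))"
      using c4(2,3) old by simp
    moreover have "{(a',b'),(b',c'),(c',d'),(d',a')} \<subseteq> parcs G'" using c4(2) sub by (rule subset_trans)
    ultimately show ?thesis using c4(1) unfolding bounded_by_4_cycle_iff[OF wfG(2)] by blast
  qed
  then have "quad_drawing G' p' \<gamma>'" using pg' conn' d3(1) by (simp add: quad_drawing_def)
  moreover have "Fh 1 \<noteq> Fh (-1)" using disj Fh_props(3)[OF s(1)] by blast
  ultimately show ?thesis using q1 q2 q3 Fh_props(4)[OF s(1)] Fh_props(4)[OF s(2)] by blast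
qed

section \<open>Sharpness\<close>

text \<open>The arcs are listed in the form in which four successive applications of
  \<open>plane_drawing_add_edge\<close> insert them.\<close>

definition square_graph :: "nat pair_pre_digraph" where
  "square_graph = \<lparr>pverts = {0, 1, 2, 3},
     parcs = {(3, 0), (0, 3), (2, 3), (3, 2), (1, 2), (2, 1), (0, 1), (1, 0)}\<rparr>"

text \<open>The square is drawn as the boundary of the diamond, so the identity parametrises its
  inner face. The outer face is only checked to be bounded by the same 4-cycle.\<close>

lemma quad_drawing_square_graph:
  "\<exists>p \<gamma> F. quad_drawing square_graph p \<gamma> \<and> quad_cell square_graph p \<gamma> 0 1 2 3 F"
proof -
  define p :: "nat \<Rightarrow> complex" where "p k = (if k = 0 then 1 else if k = 1 then \<i> else if k = 2 then -1 else -\<i>)" for k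
  define \<gamma> :: "nat \<times> nat \<Rightarrow> real \<Rightarrow> complex" where "\<gamma> = (\<lambda>(u, v). linepath (p u) (p v))"
  have p: "p 0 = 1" "p 1 = \<i>" "p (Suc 0) = \<i>" "p 2 = -1" "p 3 = -\<i>" by (simp_all add: p_def)
  have inj: "inj_on p {0, 1, 2, 3}" by (auto simp: inj_on_def p complex_eq_iff)
  have \<gamma>: "path_image (\<gamma> (u, v)) = closed_segment (p u) (p v)" for u v by (simp add: \<gamma>_def)
  \<comment> \<open>\<open>\<gamma>\<close> assigns straight segments to all pairs from the outset,
    so the updates made when an edge is added have no effect and a single \<open>\<gamma>\<close>
    serves at every stage.\<close>
  have upd: "\<gamma>((u, v) := linepath (p u) (p v), (v, u) := linepath (p v) (p u)) = \<gamma>" for u v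
    by (rule ext) (auto simp: \<gamma>_def)
  have add: "plane_drawing \<lparr>pverts = V, parcs = insert (u, v) (insert (v, u) A)\<rparr> p \<gamma> \<and>
      drawing_image \<lparr>pverts = V, parcs = insert (u, v) (insert (v, u) A)\<rparr> p \<gamma> = X \<union> closed_segment (p u) (p v)"
    if "plane_drawing \<lparr>pverts = V, parcs = A\<rparr> p \<gamma> \<and> drawing_image \<lparr>pverts = V, parcs = A\<rparr> p \<gamma> = X"
      "A \<subseteq> V \<times> V" "u \<in> V" "v \<in> V" "(u, v) \<notin> A" "(v, u) \<notin> A" "p u \<noteq> p v"
      "closed_segment (p u) (p v) \<inter> X = {p u, p v}" for V A u v X
    using plane_drawing_add_edge[of "\<lparr>pverts = V, parcs = A\<rparr>" p \<gamma> u v "linepath (p u) (p v)"] that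
    by (simp add: upd del: fun_upd_apply)
  let ?V = "{0, 1, 2, 3} :: nat set"
  let ?X = "{1, \<i>, -1, -\<i>} :: complex set"
  have d0: "plane_drawing \<lparr>pverts = ?V, parcs = {}\<rparr> p \<gamma> \<and> drawing_image \<lparr>pverts = ?V, parcs = {}\<rparr> p \<gamma> = ?X"
    using inj by (simp add: plane_drawing_def drawing_image_def p)
  have d1: "plane_drawing \<lparr>pverts = ?V, parcs = {(0, 1), (1, 0)}\<rparr> p \<gamma> \<and>
      drawing_image \<lparr>pverts = ?V, parcs = {(0, 1), (1, 0)}\<rparr> p \<gamma> = ?X \<union> closed_segment (p 0) (p 1)"
    by (rule add[OF d0]) (auto simp: p diamond_sides complex_eq_iff)
  have d2: "plane_drawing \<lparr>pverts = ?V, parcs = {(1, 2), (2, 1), (0, 1), (1, 0)}\<rparr> p \<gamma> \<and>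
      drawing_image \<lparr>pverts = ?V, parcs = {(1, 2), (2, 1), (0, 1), (1, 0)}\<rparr> p \<gamma> =
        ?X \<union> closed_segment (p 0) (p 1) \<union> closed_segment (p 1) (p 2)"
    by (rule add[OF d1]) (auto simp: p diamond_sides complex_eq_iff)
  have d3: "plane_drawing \<lparr>pverts = ?V, parcs = {(2, 3), (3, 2), (1, 2), (2, 1), (0, 1), (1, 0)}\<rparr> p \<gamma> \<and>
      drawing_image \<lparr>pverts = ?V, parcs = {(2, 3), (3, 2), (1, 2), (2, 1), (0, 1), (1, 0)}\<rparr> p \<gamma> =
        ?X \<union> closed_segment (p 0) (p 1) \<union> closed_segment (p 1) (p 2) \<union> closed_segment (p 2) (p 3)"
    by (rule add[OF d2]) (auto simp: p diamond_sides complex_eq_iff)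
  have d4: "plane_drawing square_graph p \<gamma> \<and> drawing_image square_graph p \<gamma> =
      ?X \<union> closed_segment (p 0) (p 1) \<union> closed_segment (p 1) (p 2) \<union> closed_segment (p 2) (p 3) \<union> closed_segment (p 3) (p 0)"
    unfolding square_graph_def
    by (rule add[OF d3]) (auto simp: p diamond_sides complex_eq_iff)
  have X: "drawing_image square_graph p \<gamma> = diamond - open_diamond"
    unfolding diamond_boundary conjunct2[OF d4] p by auto
  have faces: "drawing_faces square_graph p \<gamma> = {open_diamond, - diamond}"
    unfolding drawing_faces_def
  proof (rule components_open_unique)
    show "pairwise disjnt {open_diamond, - diamond}"
      using open_diamond_subset by (auto simp: pairwise_def disjnt_def)
    show "\<Union> {open_diamond, - diamond} = - drawing_image square_graph p \<gamma>"
      unfolding X using open_diamond_subset by auto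
    have "connected (- diamond)"
      by (rule connected_complement_bounded_convex)
        (simp_all add: compact_imp_bounded compact_diamond convex_diamonds)
    moreover have "open (- diamond)" by (simp add: compact_imp_closed compact_diamond open_Compl)
    moreover have "2 \<in> - diamond" "0 \<in> open_diamond" by (simp_all add: diamond_def open_diamond_def)
    ultimately show "open A \<and> connected A \<and> A \<noteq> {}" if "A \<in> {open_diamond, - diamond}" for A
      using that open_open_diamond convex_connected[OF convex_diamonds(2)] by blast
  qed
  have pg: "pair_graph square_graph"
  proof -
    have "sym (parcs square_graph)" by (auto simp: square_graph_def sym_def)
    then show ?thesis by unfold_locales (auto simp: square_graph_def symmetric_def)
  qed
  have cell: "quad_cell square_graph p \<gamma> 0 1 2 3 open_diamond"
  proof -
    have "cell_param p \<gamma> 0 1 2 3 open_diamond id"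
      unfolding cell_param_def \<gamma> by (simp add: p)
    then show ?thesis unfolding quad_cell_def faces by (auto simp: square_graph_def)
  qed
  have conn: "Digraph_Component.connected (with_proj square_graph)"
  proof -
    let ?A = "parcs square_graph"
    have s: "(0, 1) \<in> ?A\<^sup>*" "(1, 2) \<in> ?A\<^sup>*" "(2, 3) \<in> ?A\<^sup>*" "(1, 0) \<in> ?A\<^sup>*" "(2, 1) \<in> ?A\<^sup>*" "(3, 2) \<in> ?A\<^sup>*"
      by (auto simp: square_graph_def)
    have "(0, u) \<in> ?A\<^sup>* \<and> (u, 0) \<in> ?A\<^sup>*" if "u \<in> {0, 1, 2, 3}" for u
      using that s by (elim insertE emptyE) (auto intro: rtrancl_trans)
    then have "(u, v) \<in> ?A\<^sup>*" if "u \<in> {0, 1, 2, 3}" "v \<in> {0, 1, 2, 3}" for u v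
      using that by (meson rtrancl_trans)
    then show ?thesis unfolding connected_iff_rtrancl[OF pg] by (auto simp: square_graph_def)
  qed
  have "bounded_by_4_cycle square_graph \<gamma> (- diamond)"
  proof -
    have wf: "pair_wf_digraph square_graph"
      using pg by (simp add: pair_graph_def pair_digraph_def pair_fin_digraph_def)
    have "closure diamond = diamond" by (simp add: compact_imp_closed compact_diamond)
    then have "frontier diamond = diamond - open_diamond"
      by (simp add: frontier_def interior_diamond)
    then have "frontier (- diamond) = diamond - open_diamond" by (simp only: frontier_complement)
    then have "frontier (- diamond) = path_image (\<gamma> (0, 1)) \<union> path_image (\<gamma> (1, 2)) \<union> path_image (\<gamma> (2, 3)) \<union> path_image (\<gamma> (3, 0))"
      unfolding \<gamma> p diamond_boundary .
    moreover have "{(0, 1), (1, 2), (2, 3), (3, 0)} \<subseteq> parcs square_graph" by (auto simp: square_graph_def)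
    moreover have "distinct [0, 1, 2, 3 :: nat]" by simp
    ultimately show ?thesis unfolding bounded_by_4_cycle_iff[OF wf] by blast
  qed
  then have "quad_drawing square_graph p \<gamma>"
    unfolding quad_drawing_def faces using pg conn d4 quad_cell_bounded_by_4_cycle[OF pg cell] by blast
  with cell show ?thesis by blast
qed

section \<open>Bookkeeping for repeated insertions\<close>

lemma quad_drawing_pair_graph: "quad_drawing G p \<gamma> \<Longrightarrow> pair_graph G"
  by (simp add: quad_drawing_def)

lemma quad_cell_verts:
  assumes "quad_drawing G p \<gamma>" "quad_cell G p \<gamma> a b c d F"
  shows "a \<in> pverts G" "b \<in> pverts G" "c \<in> pverts G" "d \<in> pverts G"
proof -
  interpret pair_graph G using assms(1) by (rule quad_drawing_pair_graph)
  show "a \<in> pverts G" "b \<in> pverts G" "c \<in> pverts G" "d \<in> pverts G"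
    using quad_cell_arcs[OF assms(2)] in_arcsD1 by blast+
qed

text \<open>Distinct faces are disjoint, so a face other than \<open>F\<close> cannot coincide with
  a nonempty piece of \<open>F\<close>. This keeps the untouched cells apart from the piece in which
  the next insertion takes place.\<close>

lemma quad_cell_neq_subset:
  assumes "quad_cell G p \<gamma> a b c d F" "quad_cell G p \<gamma> a' b' c' d' F'" "F' \<noteq> F"
    and "quad_cell H q \<delta> a2 b2 c2 d2 F1" "F1 \<subseteq> F"
  shows "F' \<noteq> F1"
proof -
  have "F \<in> components (- drawing_image G p \<gamma>)" "F' \<in> components (- drawing_image G p \<gamma>)"
    and 1: "F1 \<in> components (- drawing_image H q \<delta>)"
    using assms by (simp_all add: quad_cell_def drawing_faces_def)
  then have "F \<inter> F' = {}" using components_eq[of F _ F'] assms(3) by blast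
  then show ?thesis using assms(5) in_components_nonempty[OF 1] by blast
qed

lemma finite_pverts: "quad_drawing G p \<gamma> \<Longrightarrow> finite (pverts G)"
  using quad_drawing_pair_graph[of G p \<gamma>] pair_fin_digraph.pair_finite_verts[of G]
  by (simp add: pair_graph_def pair_digraph_def)

lemma fresh_vertex:
  fixes G :: "nat pair_pre_digraph"
  assumes "quad_drawing G p \<gamma>"
  obtains x where "x \<notin> pverts G"
  using ex_new_if_finite[OF infinite_UNIV_nat finite_pverts[OF assms]] by blast

text \<open>Tailored to carry independent sets and lower bounds on degrees over to the larger graph,
  and stable under composition.\<close>

definition graph_extension :: "'a pair_pre_digraph \<Rightarrow> 'a pair_pre_digraph \<Rightarrow> bool" where
  "graph_extension G G' \<longleftrightarrow> pverts G \<subseteq> pverts G' \<and> parcs G' \<inter> (pverts G \<times> pverts G) \<subseteq> parcs G \<and>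
     (\<forall>v\<in>pverts G. out_degree (with_proj G) v \<le> out_degree (with_proj G') v)"

lemma graph_extension_refl: "graph_extension G G"
  by (auto simp: graph_extension_def)

lemma graph_extension_trans:
  assumes "graph_extension G G'" "graph_extension G' G''"
  shows "graph_extension G G''"
  unfolding graph_extension_def
proof (intro conjI ballI)
  show "pverts G \<subseteq> pverts G''" using assms by (auto simp: graph_extension_def)
  show "parcs G'' \<inter> (pverts G \<times> pverts G) \<subseteq> parcs G" using assms unfolding graph_extension_def by blast
  show "out_degree (with_proj G) v \<le> out_degree (with_proj G'') v" if "v \<in> pverts G" for v
    using assms that unfolding graph_extension_def by (meson order_trans subsetD)
qed

lemma graph_extension_add_vertex:
  assumes "pair_graph G" "b \<in> pverts G" "d \<in> pverts G" "x \<notin> pverts G" "b \<noteq> d"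
  shows "graph_extension G (add_vertex G b d x)"
  unfolding graph_extension_def
proof (intro conjI ballI)
  show "out_degree (with_proj G) v \<le> out_degree (with_proj (add_vertex G b d x)) v" if "v \<in> pverts G" for v
    unfolding out_degree_add_vertex[OF assms] using that assms(4) by auto
qed (use assms(4) in \<open>auto simp: add_vertex_def\<close>)

lemma independent_set_extension:
  assumes "independent_set G I" "graph_extension G G'"
  shows "independent_set G' I"
  using assms unfolding independent_set_def graph_extension_def by blast

lemma independent_set_add_vertex:
  assumes G: "pair_graph G" and I: "independent_set G I" and x: "x \<notin> pverts G" and "b \<notin> I" "d \<notin> I"
    and "b \<in> pverts G" "d \<in> pverts G"
  shows "independent_set (add_vertex G b d x) (insert x I)"
proof -
  interpret pair_graph G by fact
  have "b \<noteq> x" "d \<noteq> x" "x \<notin> I" using assms by (auto simp: independent_set_def)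
  moreover have "(x, v) \<notin> parcs G" "(v, x) \<notin> parcs G" for v using x in_arcsD1 in_arcsD2 by blast+
  ultimately show ?thesis using assms(2,4,5) by (auto simp: independent_set_def add_vertex_def)
qed

lemma card_add_vertex:
  "finite (pverts G) \<Longrightarrow> x \<notin> pverts G \<Longrightarrow> card (pverts (add_vertex G b d x)) = card (pverts G) + 1"
  by (simp add: add_vertex_def)

text \<open>Each round puts a common neighbour of \<open>s\<close> and \<open>t\<close> into the
  cell. The latest such vertex replaces \<open>e\<close> as the fourth corner while \<open>b\<close>
  stays, which is why the induction generalises over \<open>e\<close> and \<open>F\<close>.\<close>

lemma ladder_in_cell:
  fixes G :: "nat pair_pre_digraph"
  assumes "quad_drawing G p \<gamma>" "quad_cell G p \<gamma> s b t e F"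
  shows "\<exists>G' p' \<gamma>'. quad_drawing G' p' \<gamma>' \<and> graph_extension G G' \<and> card (pverts G') = card (pverts G) + k \<and>
    out_degree (with_proj G) s + k \<le> out_degree (with_proj G') s \<and>
    out_degree (with_proj G) t + k \<le> out_degree (with_proj G') t \<and>
    (\<forall>a' b' c' d' F'. quad_cell G p \<gamma> a' b' c' d' F' \<longrightarrow> F' \<noteq> F \<longrightarrow> quad_cell G' p' \<gamma>' a' b' c' d' F')"
  using assms
proof (induction k arbitrary: G p \<gamma> e F)
  case 0
  then show ?case using graph_extension_refl by (intro exI[of _ G] exI[of _ p] exI[of _ \<gamma>]) simp
next
  case (Suc k)
  note Q = Suc.prems(1) and cell = Suc.prems(2)
  note V = quad_cell_verts[OF Q cell]
  have pg: "pair_graph G" using Q by (rule quad_drawing_pair_graph)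
  obtain x where x: "x \<notin> pverts G" using fresh_vertex[OF Q] by blast
  have ts: "t \<noteq> s" using quad_cell_distinct[OF cell] by auto
  define G1 where "G1 = add_vertex G t s x"
  \<comment> \<open>One rotation moves \<open>t\<close> and \<open>s\<close> to the second and
    fourth places, the ones to which the new vertex is joined; three more restore the original
    order.\<close>
  obtain p1 \<gamma>1 F1 where Q1: "quad_drawing G1 p1 \<gamma>1" and c1: "quad_cell G1 p1 \<gamma>1 b t x s F1" and F1: "F1 \<subseteq> F"
    and keep: "\<forall>a' b' c' d' F'. quad_cell G p \<gamma> a' b' c' d' F' \<longrightarrow> F' \<noteq> F \<longrightarrow> quad_cell G1 p1 \<gamma>1 a' b' c' d' F'"
    using add_vertex_in_cell[OF Q quad_cell_rotate[OF cell] x] unfolding G1_def by blast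
  have "quad_cell G1 p1 \<gamma>1 s b t x F1"
    by (rule quad_cell_rotate[OF quad_cell_rotate[OF quad_cell_rotate[OF c1]]])
  from Suc.IH[OF Q1 this] obtain G' p' \<gamma>' where Q': "quad_drawing G' p' \<gamma>'" and ext: "graph_extension G1 G'"
    and card: "card (pverts G') = card (pverts G1) + k"
    and deg: "out_degree (with_proj G1) s + k \<le> out_degree (with_proj G') s"
      "out_degree (with_proj G1) t + k \<le> out_degree (with_proj G') t"
    and keep': "\<forall>a' b' c' d' F'. quad_cell G1 p1 \<gamma>1 a' b' c' d' F' \<longrightarrow> F' \<noteq> F1 \<longrightarrow> quad_cell G' p' \<gamma>' a' b' c' d' F'"
    by blast
  have st_ne: "s \<noteq> x" "t \<noteq> x" using V x by auto
  have "graph_extension G G1"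
    unfolding G1_def by (rule graph_extension_add_vertex[OF pg V(3,1) x ts])
  then have "graph_extension G G'" using ext by (rule graph_extension_trans)
  moreover have "card (pverts G') = card (pverts G) + Suc k"
    using card card_add_vertex[OF finite_pverts[OF Q] x] by (simp add: G1_def)
  moreover have "out_degree (with_proj G1) s = out_degree (with_proj G) s + 1"
    "out_degree (with_proj G1) t = out_degree (with_proj G) t + 1"
    unfolding G1_def out_degree_add_vertex[OF pg V(3,1) x ts] using st_ne by simp_all
  then have "out_degree (with_proj G) s + Suc k \<le> out_degree (with_proj G') s"
    "out_degree (with_proj G) t + Suc k \<le> out_degree (with_proj G') t" using deg by simp_all
  moreover have "quad_cell G' p' \<gamma>' a' b' c' d' F'" if "quad_cell G p \<gamma> a' b' c' d' F'" "F' \<noteq> F" for a' b' c' d' F'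
    using keep[rule_format, OF that] keep' quad_cell_neq_subset[OF cell that c1 F1] by blast
  ultimately show ?case using Q' by blast
qed

text \<open>The invariant of the construction: all vertices of $I$ have reached degree $d$ except for
  two opposite corners of one face, whose other corners are the poles $N$ and $S$.\<close>

definition block_state ::
  "nat \<Rightarrow> nat \<Rightarrow> nat pair_pre_digraph \<Rightarrow> (nat \<Rightarrow> complex) \<Rightarrow> (nat \<times> nat \<Rightarrow> real \<Rightarrow> complex) \<Rightarrow>
     nat \<Rightarrow> nat \<Rightarrow> nat \<Rightarrow> nat \<Rightarrow> complex set \<Rightarrow> nat set \<Rightarrow> bool" where
  "block_state d j G p \<gamma> u N c S F I \<longleftrightarrow> quad_drawing G p \<gamma> \<and> quad_cell G p \<gamma> u N c S F \<and>
     card (pverts G) = 4 + d * j \<and> independent_set G I \<and> card I = 2 + 2 * j \<and>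
     N \<notin> I \<and> S \<notin> I \<and> u \<in> I \<and> c \<in> I \<and>
     2 \<le> out_degree (with_proj G) u \<and> 2 \<le> out_degree (with_proj G) c \<and>
     (\<forall>v\<in>I - {u, c}. d \<le> out_degree (with_proj G) v)"

lemma block_state_0: "\<exists>G p \<gamma> u N c S F I. block_state d 0 G p \<gamma> u N c S F I"
proof -
  obtain p \<gamma> F where "quad_drawing square_graph p \<gamma>" "quad_cell square_graph p \<gamma> 0 1 2 3 F"
    using quad_drawing_square_graph by blast
  moreover have "card (pverts square_graph) = 4" "independent_set square_graph {0, 2}"
    by (auto simp: square_graph_def independent_set_def)
  moreover have "{e \<in> parcs square_graph. fst e = 0} = {(0, 1), (0, 3)}"
    "{e \<in> parcs square_graph. fst e = 2} = {(2, 1), (2, 3)}"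
    by (auto simp: square_graph_def)
  then have "out_degree (with_proj square_graph) 0 = 2" "out_degree (with_proj square_graph) 2 = 2"
    by (simp_all add: out_degree_with_proj)
  ultimately have "block_state d 0 square_graph p \<gamma> 0 1 2 3 F {0, 2}"
    by (simp add: block_state_def)
  then show ?thesis by blast
qed

text \<open>A step adds $1 + (d-2) + 1 = d$ vertices: \<open>v\<close>, which completes a block
  together with \<open>u\<close>; the $d-2$ common neighbours of \<open>u\<close> and
  \<open>v\<close>; and \<open>w\<close>, which takes the place of \<open>u\<close> beside
  \<open>c\<close>. Of these, \<open>v\<close> and \<open>w\<close> join \<open>I\<close>.\<close>

lemma block_state_Suc:
  assumes d: "d \<ge> 2" and st: "block_state d j G p \<gamma> u N c S F I"
  shows "\<exists>G p \<gamma> u N c S F I. block_state d (Suc j) G p \<gamma> u N c S F I"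
proof -
  have Q: "quad_drawing G p \<gamma>" and cell: "quad_cell G p \<gamma> u N c S F" and n: "card (pverts G) = 4 + d * j"
    and I: "independent_set G I" "card I = 2 + 2 * j" "N \<notin> I" "S \<notin> I" "u \<in> I" "c \<in> I"
    and deg: "2 \<le> out_degree (with_proj G) u" "2 \<le> out_degree (with_proj G) c"
      "\<And>v. v \<in> I - {u, c} \<Longrightarrow> d \<le> out_degree (with_proj G) v"
    using st by (auto simp: block_state_def)
  have pg: "pair_graph G" using Q by (rule quad_drawing_pair_graph)
  note V = quad_cell_verts[OF Q cell]
  have IV: "I \<subseteq> pverts G" using I(1) by (simp add: independent_set_def)
  have ne: "N \<noteq> S" "u \<noteq> c" "u \<noteq> N" "u \<noteq> S" "c \<noteq> N" "c \<noteq> S" using quad_cell_distinct[OF cell] by auto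
  obtain v where v: "v \<notin> pverts G" using fresh_vertex[OF Q] by blast
  define G1 where "G1 = add_vertex G N S v"
  obtain p1 \<gamma>1 F1 F2 where Q1: "quad_drawing G1 p1 \<gamma>1" and c1: "quad_cell G1 p1 \<gamma>1 u N v S F1"
    and c2: "quad_cell G1 p1 \<gamma>1 v N c S F2" and "F1 \<noteq> F2"
    using add_vertex_in_cell[OF Q cell v] unfolding G1_def by blast
  have e1: "graph_extension G G1"
    unfolding G1_def by (rule graph_extension_add_vertex[OF pg V(2,4) v ne(1)])
  have I1: "independent_set G1 (insert v I)"
    unfolding G1_def by (rule independent_set_add_vertex[OF pg I(1) v I(3,4) V(2,4)])
  have n1: "card (pverts G1) = 5 + d * j"
    using card_add_vertex[OF finite_pverts[OF Q] v] n by (simp add: G1_def)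
  have deg_v: "out_degree (with_proj G1) v = 2"
    unfolding G1_def out_degree_add_vertex[OF pg V(2,4) v ne(1)] by simp
  \<comment> \<open>Both \<open>u\<close> and \<open>v\<close> have degree at least 2 beforehand, so
    $d-2$ further neighbours suffice. They go between \<open>u\<close> and \<open>v\<close>, which
    leaves the cell \<open>F2\<close> between \<open>v\<close> and \<open>c\<close> free.\<close>
  from ladder_in_cell[OF Q1 c1, of "d - 2"] obtain G2 p2 \<gamma>2 where Q2: "quad_drawing G2 p2 \<gamma>2"
    and e2: "graph_extension G1 G2" and n2: "card (pverts G2) = card (pverts G1) + (d - 2)"
    and deg2: "out_degree (with_proj G1) u + (d - 2) \<le> out_degree (with_proj G2) u"
      "out_degree (with_proj G1) v + (d - 2) \<le> out_degree (with_proj G2) v"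
    and c2': "quad_cell G2 p2 \<gamma>2 v N c S F2" using c2 \<open>F1 \<noteq> F2\<close> by blast
  note V2 = quad_cell_verts[OF Q2 c2']
  have pg2: "pair_graph G2" using Q2 by (rule quad_drawing_pair_graph)
  obtain w where w: "w \<notin> pverts G2" using fresh_vertex[OF Q2] by blast
  define G3 where "G3 = add_vertex G2 N S w"
  \<comment> \<open>\<open>v\<close> is already complete, so \<open>w\<close> shields it: the
    surviving cell has the unfinished vertices \<open>w\<close> and \<open>c\<close> as opposite
    corners.\<close>
  obtain p3 \<gamma>3 F3 where Q3: "quad_drawing G3 p3 \<gamma>3" and c3: "quad_cell G3 p3 \<gamma>3 w N c S F3"
    using add_vertex_in_cell[OF Q2 c2' w] unfolding G3_def by blast
  have e3: "graph_extension G2 G3"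
    unfolding G3_def by (rule graph_extension_add_vertex[OF pg2 V2(2,4) w ne(1)])
  have "N \<noteq> v" "S \<noteq> v" using V v by auto
  then have NS: "N \<notin> insert v I" "S \<notin> insert v I" using I by auto
  have I2: "independent_set G2 (insert v I)" by (rule independent_set_extension[OF I1 e2])
  have I3: "independent_set G3 (insert w (insert v I))"
    unfolding G3_def by (rule independent_set_add_vertex[OF pg2 I2 w NS V2(2,4)])
  have sub2: "insert v I \<subseteq> pverts G2" using I2 by (simp add: independent_set_def)
  have finI: "finite I" using IV finite_pverts[OF Q] finite_subset by blast
  have vI: "v \<notin> I" and wI: "w \<notin> insert v I" using v IV w sub2 by blast+
  have cI: "card (insert w (insert v I)) = 2 + 2 * Suc j"
    using finI vI wI I(2) by simp
  have n3: "card (pverts G3) = 4 + d * Suc j"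
    using card_add_vertex[OF finite_pverts[OF Q2] w] n2 n1 d by (simp add: G3_def)
  have mono13: "out_degree (with_proj G) x \<le> out_degree (with_proj G3) x" if "x \<in> I" for x
    using graph_extension_trans[OF graph_extension_trans[OF e1 e2] e3] that IV by (auto simp: graph_extension_def)
  have mono23: "out_degree (with_proj G2) x \<le> out_degree (with_proj G3) x" if "x \<in> insert v I" for x
    using e3 that sub2 by (auto simp: graph_extension_def)
  have mono01: "out_degree (with_proj G) u \<le> out_degree (with_proj G1) u"
    using e1 V by (auto simp: graph_extension_def)
  have "d \<le> out_degree (with_proj G3) x" if x: "x \<in> insert w (insert v I) - {w, c}" for x
  proof -
    consider "x = v" | "x = u" | "x \<in> I - {u, c}" using x by blast
    then show ?thesis
    proof cases
      case 1
      then show ?thesis using deg2(2) deg_v mono23[of v] d by simp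
    next
      case 2
      then show ?thesis using deg2(1) mono01 deg(1) mono23[of u] I(5) d by simp
    next
      case 3
      then show ?thesis using deg(3)[of x] mono13[of x] by simp
    qed
  qed
  moreover have "out_degree (with_proj G3) w = 2"
    unfolding G3_def out_degree_add_vertex[OF pg2 V2(2,4) w ne(1)] by simp
  moreover have "2 \<le> out_degree (with_proj G3) c" using deg(2) mono13[OF I(6)] by simp
  moreover have "N \<notin> insert w (insert v I)" "S \<notin> insert w (insert v I)" using NS V2(2,4) w by auto
  ultimately have "block_state d (Suc j) G3 p3 \<gamma>3 w N c S F3 (insert w (insert v I))"
    unfolding block_state_def using Q3 c3 n3 I3 cI I(6) by simp
  then show ?thesis by blast
qed

lemma block_state_exists:
  assumes "d \<ge> 2"
  shows "\<exists>G p \<gamma> u N c S F I. block_state d j G p \<gamma> u N c S F I"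
proof (induction j)
  case 0
  show ?case by (rule block_state_0)
next
  case (Suc j)
  then show ?case using block_state_Suc[OF assms] by blast
qed

text \<open>A last ladder of $d-2$ vertices completes the open pair \<open>u\<close>,
  \<open>c\<close>, and $4 + dj + (d-2) = 2 + d(j+1)$. The parameter \<open>Suc j\<close> is the
  number of blocks.\<close>

lemma d_independent_set_attained:
  assumes d: "d \<ge> 2"
  shows "\<exists>(G :: nat pair_pre_digraph) I. simple_quadrangulated_graph G \<and>
    card (pverts G) = 2 + d * Suc j \<and> d_independent_set d G I \<and> card I = 2 * Suc j"
proof -
  obtain G p \<gamma> u N c S F I where st: "block_state d j G p \<gamma> u N c S F I"
    using block_state_exists[OF d] by blast
  then have Q: "quad_drawing G p \<gamma>" and cell: "quad_cell G p \<gamma> u N c S F" and n: "card (pverts G) = 4 + d * j"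
    and I: "independent_set G I" "card I = 2 + 2 * j"
    and deg: "2 \<le> out_degree (with_proj G) u" "2 \<le> out_degree (with_proj G) c"
      "\<And>v. v \<in> I - {u, c} \<Longrightarrow> d \<le> out_degree (with_proj G) v"
    by (auto simp: block_state_def)
  from ladder_in_cell[OF Q cell, of "d - 2"] obtain G' p' \<gamma>' where Q': "quad_drawing G' p' \<gamma>'"
    and e: "graph_extension G G'" and n': "card (pverts G') = card (pverts G) + (d - 2)"
    and deg': "out_degree (with_proj G) u + (d - 2) \<le> out_degree (with_proj G') u"
      "out_degree (with_proj G) c + (d - 2) \<le> out_degree (with_proj G') c" by blast
  have "d \<le> out_degree (with_proj G') v" if v: "v \<in> I" for v
  proof (cases "v \<in> {u, c}")
    case True
    then show ?thesis using deg deg' d by auto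
  next
    case False
    have "v \<in> pverts G" using v I(1) by (auto simp: independent_set_def)
    then have "out_degree (with_proj G) v \<le> out_degree (with_proj G') v"
      using e by (simp add: graph_extension_def)
    then show ?thesis using deg(3)[of v] v False by simp
  qed
  then have "d_independent_set d G' I"
    unfolding d_independent_set_def using independent_set_extension[OF I(1) e] by blast
  moreover have "card (pverts G') = 2 + d * Suc j" using n n' d by simp
  moreover have "simple_quadrangulated_graph G'"
    using Q' \<open>card (pverts G') = 2 + d * Suc j\<close> d
    unfolding simple_quadrangulated_graph_def quadrangulated_def quad_drawing_def by auto
  ultimately show ?thesis using I(2) by (intro exI[of _ G'] exI[of _ I]) simp
qed

theorem theorem5p1:
  fixes d :: nat
  assumes "d \<ge> 2"
  shows "(\<forall>(G :: 'a pair_pre_digraph) I.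
            simple_quadrangulated_graph G \<longrightarrow> d_independent_set d G I \<longrightarrow>
              real (card I) \<le> 2 / real d * (real (card (pverts G)) - 2)) \<and>
         (\<forall>N. \<exists>n\<ge>N. \<exists>(G :: nat pair_pre_digraph) I.
            simple_quadrangulated_graph G \<and> card (pverts G) = n \<and> d_independent_set d G I \<and>
              real (card I) = 2 / real d * (real n - 2))"
proof (intro conjI allI impI)
  fix G :: "'a pair_pre_digraph" and I
  assume "simple_quadrangulated_graph G" "d_independent_set d G I"
  then show "real (card I) \<le> 2 / real d * (real (card (pverts G)) - 2)"
    using assms by (intro d_independent_set_upper_bound) auto
next
  fix N
  obtain G :: "nat pair_pre_digraph" and I where G: "simple_quadrangulated_graph G"
    "card (pverts G) = 2 + d * Suc N" "d_independent_set d G I" "card I = 2 * Suc N"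
    using d_independent_set_attained[OF assms, of N] by blast
  have "Suc N \<le> d * Suc N" using assms by (metis One_nat_def Suc_1 Suc_leD mult_le_mono1 nat_mult_1)
  then have "2 + d * Suc N \<ge> N" by linarith
  moreover have "real (card I) = 2 / real d * (real (2 + d * Suc N) - 2)"
    using assms unfolding G(4) by (simp add: field_simps)
  ultimately show "\<exists>n\<ge>N. \<exists>(G :: nat pair_pre_digraph) I.
            simple_quadrangulated_graph G \<and> card (pverts G) = n \<and> d_independent_set d G I \<and>
              real (card I) = 2 / real d * (real n - 2)"
    using G(1-3) by blast
qed

end
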